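(* A depth-first search (DFS) of a directed or undirected graph $G$ with $n$ vertices and $m$ edges can be carried out in $O(n+m)$ time with at most $n+\frac{4}{5}m+O(\log n)$ bits of working memory.
   Context: $\log$ denotes $\log_2$. Model of computation: word RAM with word length $\Omega(\log n)$ bits and constant-time standard word operations; the input is read-only, the output (if any) is write-only, and space is the number of bits of working memory, not counting input and output. Input representation: the vertex set is $V=\{1,\ldots,n\}$ for a known integer $n\ge 1$. For an undirected graph, the constant-time access functions are: $\mathrm{deg}(u)$, the degree of $u\in V$; for $u\in V$ and $i\in\{0,\ldots,\mathrm{deg}(u)-1\}$, $\mathrm{head}(u,i)$, the $(i+1)$st neighbor $v$ of $u$ in some arbitrary fixed ordering of the neighbors of $u$, and $\mathrm{mate}(u,i)$, the integer $j$ with $\mathrm{head}(v,j)=u$. A directed graph is represented with in/out adjacency arrays, i.e., the inneighbors as well as the outneighbors of each vertex can be accessed one by one, and there are cross links: for each edge $(u,v)$, the function $\mathrm{mate}$ maps in constant time the position of $v$ in the adjacency array of $u$ to that of $u$ in the adjacency array of $v$ and vice versa. A DFS visits all vertices and edges of $G$. Vertices are initially white, become gray when discovered, and turn black when all their incident edges (outgoing edges, if $G$ is directed) have been explored. At the outermost level the DFS steps through the vertices in some order (the root order) and starts a new tree at each vertex not yet discovered. It obeys the DFS rule: whenever two or more discovered vertices have unexplored incident (out)edges, an (out)edge incident on the most recently discovered such vertex (the current vertex) is explored first; if it leads to a white vertex $w$, then $w$ is discovered and becomes the current vertex. Carrying out a DFS means executing such a traversal, invoking user procedures at the appropriate events (a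 vertex turning gray or black; exploration of an edge from the current vertex, distinguishing whether or not it leads to a new vertex; withdrawal over a tree edge). The resources of the user procedures themselves are not counted. *)

theory Defs
  imports Complex_Main "HOL-Library.Landau_Symbols" "HOL-Library.Log_Nat"
begin

section \<open>Graphs and their representation\<close>

text \<open>The vertex set is always \<open>{1..n}\<close>. Graphs have no parallel edges, so that the mate of a
  position is well-defined.\<close>

definition undirected_graph :: "nat \<Rightarrow> nat set set \<Rightarrow> bool" where
  "undirected_graph n E \<longleftrightarrow> 1 \<le> n \<and> (\<forall>e\<in>E. e \<subseteq> {1..n} \<and> card e = 2)"

definition directed_graph :: "nat \<Rightarrow> (nat \<times> nat) set \<Rightarrow> bool" where
  "directed_graph n E \<longleftrightarrow> 1 \<le> n \<and> E \<subseteq> {1..n} \<times> {1..n}"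

text \<open>The index type \<open>'a\<close> selects one of the adjacency arrays of a vertex: \<open>unit\<close> for an
  undirected graph, \<open>side\<close> for a directed one. In a directed graph \<open>deg Out u\<close> is the outdegree
  of \<open>u\<close>, \<open>head In u i\<close> its \<open>(i+1)\<close>st inneighbor, and \<open>mate\<close> is the cross link to the array of
  the other kind.\<close>

record 'a access =
  deg :: "'a \<Rightarrow> nat \<Rightarrow> nat"
  head :: "'a \<Rightarrow> nat \<Rightarrow> nat \<Rightarrow> nat"
  mate :: "'a \<Rightarrow> nat \<Rightarrow> nat \<Rightarrow> nat"

datatype side = Out | In

fun opposite :: "side \<Rightarrow> side" where
  "opposite Out = In"
| "opposite In = Out"

definition adjacency_arrays ::
    "nat \<Rightarrow> ('a \<Rightarrow> nat \<Rightarrow> nat set) \<Rightarrow> ('a \<Rightarrow> 'a) \<Rightarrow> 'a access \<Rightarrow> bool" where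
  "adjacency_arrays n nbrs cross I \<longleftrightarrow>
     (\<forall>a. \<forall>u\<in>{1..n}.
        bij_betw (head I a u) {..<deg I a u} (nbrs a u) \<and>
        (\<forall>i<deg I a u. let v = head I a u i; j = mate I a u i in
           j < deg I (cross a) v \<and> head I (cross a) v j = u))"

definition represents_undirected :: "nat \<Rightarrow> nat set set \<Rightarrow> unit access \<Rightarrow> bool" where
  "represents_undirected n E = adjacency_arrays n (\<lambda>_ u. {v. {u, v} \<in> E}) id"

definition represents_directed :: "nat \<Rightarrow> (nat \<times> nat) set \<Rightarrow> side access \<Rightarrow> bool" where
  "represents_directed n E = adjacency_arrays n
     (\<lambda>a u. case a of Out \<Rightarrow> {v. (u, v) \<in> E} | In \<Rightarrow> {v. (v, u) \<in> E}) opposite"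

section \<open>Depth-first search\<close>

text \<open>The events at which user procedures are invoked. \<open>Explores_new u v\<close> and \<open>Explores_old u v\<close>
  are explorations of the edge to \<open>v\<close> from the current vertex \<open>u\<close>, where \<open>v\<close> is white and nonwhite,
  respectively; \<open>Withdraws u v\<close> is the withdrawal over the tree edge \<open>(u, v)\<close> from \<open>v\<close> to \<open>u\<close>.\<close>

datatype 'v event =
  Turns_gray 'v
| Turns_black 'v
| Explores_new 'v 'v
| Explores_old 'v 'v
| Withdraws 'v 'v

text \<open>\<open>dfs_reaches A order R S W X es\<close>: a DFS with the given root order can be in a state in which
  \<open>R\<close> is the part of the root order not yet stepped through, \<open>S\<close> lists the gray vertices, the
  most recently discovered first, \<open>W\<close> is the set of white vertices, \<open>X\<close> is the set of
  unexplored edges, and \<open>es\<close> is the sequence of events so far. \<open>A\<close> contains \<open>(u, v)\<close> if there is an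
  edge to be explored from \<open>u\<close> that leads to \<open>v\<close>; an undirected edge hence contributes two pairs and
  is explored from each of its two endpoints. A vertex turns black as soon as it is the most recently
  discovered gray vertex and has no unexplored edges, so \<open>hd S\<close> is the current vertex of the DFS rule
  whenever it has an unexplored edge.\<close>

inductive dfs_reaches ::
    "('v \<times> 'v) set \<Rightarrow> 'v list \<Rightarrow> 'v list \<Rightarrow> 'v list \<Rightarrow> 'v set \<Rightarrow> ('v \<times> 'v) set \<Rightarrow> 'v event list \<Rightarrow> bool"
  for A order where
  start: "dfs_reaches A order order [] (set order) A []"
| skip_root: "dfs_reaches A order (v # R) [] W X es \<Longrightarrow> v \<notin> W \<Longrightarrow>
    dfs_reaches A order R [] W X es"
| new_root: "dfs_reaches A order (v # R) [] W X es \<Longrightarrow> v \<in> W \<Longrightarrow>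
    dfs_reaches A order R [v] (W - {v}) X (es @ [Turns_gray v])"
| explore_old: "dfs_reaches A order R (u # S) W X es \<Longrightarrow> (u, v) \<in> X \<Longrightarrow> v \<notin> W \<Longrightarrow>
    dfs_reaches A order R (u # S) W (X - {(u, v)}) (es @ [Explores_old u v])"
| explore_new: "dfs_reaches A order R (u # S) W X es \<Longrightarrow> (u, v) \<in> X \<Longrightarrow> v \<in> W \<Longrightarrow>
    dfs_reaches A order R (v # u # S) (W - {v}) (X - {(u, v)})
      (es @ [Explores_new u v, Turns_gray v])"
| finish_root: "dfs_reaches A order R [v] W X es \<Longrightarrow> v \<notin> fst ` X \<Longrightarrow>
    dfs_reaches A order R [] W X (es @ [Turns_black v])"
| finish: "dfs_reaches A order R (v # u # S) W X es \<Longrightarrow> v \<notin> fst ` X \<Longrightarrow>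
    dfs_reaches A order R (u # S) W X (es @ [Turns_black v, Withdraws u v])"

definition is_dfs :: "'v set \<Rightarrow> ('v \<times> 'v) set \<Rightarrow> 'v event list \<Rightarrow> bool" where
  "is_dfs V A es \<longleftrightarrow>
     (\<exists>order W X. set order = V \<and> distinct order \<and> dfs_reaches A order [] [] W X es)"

section \<open>The word RAM\<close>

datatype binop = Add | Sub | Mul | Div | And | Or | Xor | Shl | Shr

text \<open>Words of \<open>w\<close> bits are natural numbers below \<open>2 ^ w\<close>; arithmetic is modulo \<open>2 ^ w\<close>.\<close>

fun word_op :: "nat \<Rightarrow> binop \<Rightarrow> nat \<Rightarrow> nat \<Rightarrow> nat" where
  "word_op w Add x y = take_bit w (x + y)"
| "word_op w Sub x y = take_bit w (x + 2 ^ w - y)"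
| "word_op w Mul x y = take_bit w (x * y)"
| "word_op w Div x y = x div y"
| "word_op w And x y = semiring_bit_operations_class.and x y"
| "word_op w Or x y = semiring_bit_operations_class.or x y"
| "word_op w Xor x y = semiring_bit_operations_class.xor x y"
| "word_op w Shl x y = take_bit w (push_bit y x)"
| "word_op w Shr x y = drop_bit y x"

text \<open>Besides its registers the machine has a bit-addressable memory, of which a field of at most
  \<open>w\<close> consecutive bits can be read or written in one step (on a memory divided into words this
  amounts to a constant number of word accesses, shifts and masks). Fields rather than whole words
  make it possible to account for the space in bits even if \<open>w\<close> is much larger than \<open>log n\<close>.

  \<open>Load r a l\<close> reads the field of \<open>l\<close> bits at address \<open>a\<close> into register \<open>r\<close>; \<open>Store a l r\<close> writes
  the \<open>l\<close> low-order bits of \<open>r\<close>. \<open>Call e\<close> invokes a user procedure; its arguments are the contents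
  of the registers in \<open>e\<close>. Instructions are polymorphic in the type of registers only so
  that the datatype package supplies the set of registers occurring in an instruction.\<close>

datatype ('a, regs_of: 'r) instr =
  Const 'r nat
| Move 'r 'r
| Op binop 'r 'r 'r
| Load 'r 'r 'r
| Store 'r 'r 'r
| Jump nat
| Jump_eq 'r 'r nat
| Jump_less 'r 'r nat
| Get_n 'r
| Get_deg 'a 'r 'r
| Get_head 'a 'r 'r 'r
| Get_mate 'a 'r 'r 'r
| Call "'r event"
| Halt

type_synonym 'a ram_program = "('a, nat) instr list"

definition registers :: "'a ram_program \<Rightarrow> nat set" where
  "registers P = (\<Union>i\<in>set P. regs_of i)"

text \<open>\<open>extent\<close> is the least size of the memory that contains all fields accessed so far; \<open>calls\<close>
  records the invocations of user procedures.\<close>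

record config =
  pc :: nat
  reg :: "nat \<Rightarrow> nat"
  mem :: "nat \<Rightarrow> bool"
  extent :: nat
  calls :: "nat event list"

definition put :: "nat \<Rightarrow> nat \<Rightarrow> config \<Rightarrow> config" where
  "put r x c = c\<lparr>pc := Suc (pc c), reg := (reg c)(r := x)\<rparr>"

definition load_bits :: "(nat \<Rightarrow> bool) \<Rightarrow> nat \<Rightarrow> nat \<Rightarrow> nat" where
  "load_bits M a l = (\<Sum>i<l. of_bool (M (a + i)) * 2 ^ i)"

definition store_bits :: "(nat \<Rightarrow> bool) \<Rightarrow> nat \<Rightarrow> nat \<Rightarrow> nat \<Rightarrow> (nat \<Rightarrow> bool)" where
  "store_bits M a l x = (\<lambda>b. if a \<le> b \<and> b < a + l then bit x (b - a) else M b)"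

text \<open>The result is \<open>None\<close> if no step is possible: at \<open>Halt\<close>, but also if the program leaves its
  range, uses a field of more than \<open>w\<close> bits or violates the preconditions of an access
  function.\<close>

fun exec :: "nat \<Rightarrow> nat \<Rightarrow> 'a access \<Rightarrow> ('a, nat) instr \<Rightarrow> config \<Rightarrow> config option" where
  "exec w n I (Const r k) c = Some (put r (take_bit w k) c)"
| "exec w n I (Move r s) c = Some (put r (reg c s) c)"
| "exec w n I (Op f r s t) c = Some (put r (word_op w f (reg c s) (reg c t)) c)"
| "exec w n I (Load r a l) c =
     (if reg c l \<le> w
      then Some ((put r (load_bits (mem c) (reg c a) (reg c l)) c)
             \<lparr>extent := max (extent c) (reg c a + reg c l)\<rparr>)
      else None)"
| "exec w n I (Store a l r) c =
     (if reg c l \<le> w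
      then Some (c\<lparr>pc := Suc (pc c), mem := store_bits (mem c) (reg c a) (reg c l) (reg c r),
             extent := max (extent c) (reg c a + reg c l)\<rparr>)
      else None)"
| "exec w n I (Jump k) c = Some (c\<lparr>pc := k\<rparr>)"
| "exec w n I (Jump_eq r s k) c = Some (c\<lparr>pc := if reg c r = reg c s then k else Suc (pc c)\<rparr>)"
| "exec w n I (Jump_less r s k) c = Some (c\<lparr>pc := if reg c r < reg c s then k else Suc (pc c)\<rparr>)"
| "exec w n I (Get_n r) c = Some (put r (take_bit w n) c)"
| "exec w n I (Get_deg a r u) c =
     (if reg c u \<in> {1..n} then Some (put r (take_bit w (deg I a (reg c u))) c) else None)"
| "exec w n I (Get_head a r u i) c =
     (if reg c u \<in> {1..n} \<and> reg c i < deg I a (reg c u)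
      then Some (put r (take_bit w (head I a (reg c u) (reg c i))) c) else None)"
| "exec w n I (Get_mate a r u i) c =
     (if reg c u \<in> {1..n} \<and> reg c i < deg I a (reg c u)
      then Some (put r (take_bit w (mate I a (reg c u) (reg c i))) c) else None)"
| "exec w n I (Call e) c =
     Some (c\<lparr>pc := Suc (pc c), calls := calls c @ [map_event (reg c) e]\<rparr>)"
| "exec w n I Halt c = None"

definition step :: "nat \<Rightarrow> nat \<Rightarrow> 'a access \<Rightarrow> 'a ram_program \<Rightarrow> config \<Rightarrow> config option" where
  "step w n I P c = (if pc c < length P then exec w n I (P ! pc c) c else None)"

text \<open>The memory initially has arbitrary contents \<open>M\<close>.\<close>

definition initial :: "(nat \<Rightarrow> bool) \<Rightarrow> config" where
  "initial M = \<lparr>pc = 0, reg = (\<lambda>_. 0), mem = M, extent = 0, calls = []\<rparr>"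

definition is_run ::
    "nat \<Rightarrow> nat \<Rightarrow> 'a access \<Rightarrow> 'a ram_program \<Rightarrow> (nat \<Rightarrow> bool) \<Rightarrow> nat \<Rightarrow> (nat \<Rightarrow> config) \<Rightarrow> bool" where
  "is_run w n I P M t \<gamma> \<longleftrightarrow>
     \<gamma> 0 = initial M \<and>
     (\<forall>i<t. step w n I P (\<gamma> i) = Some (\<gamma> (Suc i))) \<and>
     pc (\<gamma> t) < length P \<and> P ! pc (\<gamma> t) = Halt"

text \<open>The working memory consists of the memory up to the highest bit ever accessed and of the
  registers, each of which needs as many bits as the largest value that it ever holds.\<close>

definition space_used :: "'a ram_program \<Rightarrow> nat \<Rightarrow> (nat \<Rightarrow> config) \<Rightarrow> nat" where
  "space_used P t \<gamma> =
     extent (\<gamma> t) + (\<Sum>r\<in>registers P. Max ((\<lambda>i. nat (bitlen (int (reg (\<gamma> i) r)))) ` {..t}))"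

text \<open>With word length \<open>w\<close> and on the input \<open>(n, I)\<close>, the program carries out a DFS of the graph
  with vertex set \<open>{1..n}\<close> and edges \<open>A\<close> (as in \<open>dfs_reaches\<close>) in \<open>t\<close> steps with \<open>s\<close> bits of
  working memory.\<close>

definition carries_out_dfs ::
    "nat \<Rightarrow> nat \<Rightarrow> 'a access \<Rightarrow> (nat \<times> nat) set \<Rightarrow> 'a ram_program \<Rightarrow> (nat \<Rightarrow> bool) \<Rightarrow> nat \<Rightarrow> nat \<Rightarrow> bool"
  where
  "carries_out_dfs w n I A P M t s \<longleftrightarrow>
     (\<exists>\<gamma>. is_run w n I P M t \<gamma> \<and> space_used P t \<gamma> = s \<and> is_dfs {1..n} A (calls (\<gamma> t)))"

end

theory Submission
  imports Defs
begin

text \<open>The gray vertices form a path, and while the search is below an inner vertex \<open>u\<close> of it, only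
  the position of the parent of \<open>u\<close> in its adjacency array needs to be remembered: on the return
  from a child, the position of the child is the mate of the position of the parent of the child.
  Besides one bit per vertex that tells white vertices apart, the memory holds a stack of these
  positions. In an undirected graph the position of the parent differs from that of the current
  child, so that \<open>d - 1\<close> values suffice for a vertex of degree \<open>d\<close>, which is worth at most
  \<open>2 * d / 5\<close> bits: this is clear for \<open>d \<ge> 8\<close>, and for \<open>d < 8\<close> five vertices of the same degree
  share a field of \<open>2 * d\<close> bits, since \<open>(d - 1) ^ 5 \<le> 4 ^ d\<close>. As the degrees add up to \<open>2 * m\<close>,
  the stack takes at most \<open>4 * m / 5\<close> bits. A directed graph is treated in the same way with
  \<open>d\<close> twice the indegree.\<close>

section \<open>A structured language for the word RAM\<close>

text \<open>The constant \<open>2 / 5\<close> is the maximum of \<open>log 2 (d - 1) / d\<close>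
  over integers \<open>d\<close>, attained at \<open>d = 5\<close>, where
  \<open>(d - 1) ^ 5 = 4 ^ d\<close>; so there is no slack to waste on rounding. A field of its own
  for every entry would waste too much: for \<open>d = 4\<close>, \<open>6\<close> and
  \<open>7\<close>, the number \<open>2 ^ (2 * d div 5)\<close> is smaller than
  \<open>d - 1\<close>. Five entries of equal \<open>d\<close>, however, are worth
  \<open>2 * d\<close> bits, an integer. Neither lengths nor tags are stored with the entries: on a
  return the vertex is known, hence its degree, and this tells where its entry lies. An entry exists
  only for a vertex with both a parent and a child on the path, so \<open>d \<ge> 2\<close>. For a
  large degree, \<open>2 * d / 5\<close> bits could exceed a word; fields are therefore capped at
  \<open>W\<close>, the bit length of \<open>n\<close>. Besides the marks and the stack there are
  256 bits of buffers and a fixed number of registers, whose contents are polynomial in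
  \<open>n\<close>.\<close>

datatype cond = Equal nat nat | Less nat nat

fun holds :: "cond \<Rightarrow> (nat \<Rightarrow> nat) \<Rightarrow> bool" where
  "holds (Equal r s) R \<longleftrightarrow> R r = R s"
| "holds (Less r s) R \<longleftrightarrow> R r < R s"

fun jump_if :: "cond \<Rightarrow> nat \<Rightarrow> ('a, nat) instr" where
  "jump_if (Equal r s) k = Jump_eq r s k"
| "jump_if (Less r s) k = Jump_less r s k"

datatype 'a com =
  Skip
| Do "('a, nat) instr"
| Seq "'a com" "'a com" (infixr ";;" 60)
| If_then_else cond "'a com" "'a com"
| While cond "'a com"

fun code_size :: "'a com \<Rightarrow> nat" where
  "code_size Skip = 0"
| "code_size (Do i) = 1"
| "code_size (C ;; D) = code_size C + code_size D"
| "code_size (If_then_else b C D) = code_size C + code_size D + 2"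
| "code_size (While b C) = code_size C + 3"

text \<open>A conditional jump is taken if the condition holds, so the else-branch is laid out
  first. Jumps are absolute, whence the start address \<open>k\<close>.\<close>

fun compile :: "nat \<Rightarrow> 'a com \<Rightarrow> 'a ram_program" where
  "compile k Skip = []"
| "compile k (Do i) = [i]"
| "compile k (C ;; D) = compile k C @ compile (k + code_size C) D"
| "compile k (If_then_else b C D) =
     jump_if b (k + code_size D + 2) # compile (k + 1) D
     @ Jump (k + code_size C + code_size D + 2) # compile (k + code_size D + 2) C"
| "compile k (While b C) =
     [jump_if b (k + 2), Jump (k + code_size C + 3)] @ compile (k + 2) C @ [Jump k]"

lemma length_compile [simp]: "length (compile k C) = code_size C"
  by (induction C arbitrary: k) auto

definition code_at :: "'b list \<Rightarrow> nat \<Rightarrow> 'b list \<Rightarrow> bool" where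
  "code_at P k xs \<longleftrightarrow> (\<exists>ys zs. P = ys @ xs @ zs \<and> length ys = k)"

lemma code_at_appendD:
  assumes "code_at P k (xs @ ys)"
  shows "code_at P k xs" and "code_at P (k + length xs) ys"
proof -
  obtain as bs where P: "P = as @ (xs @ ys) @ bs" and k: "length as = k"
    using assms unfolding code_at_def by blast
  show "code_at P k xs"
    unfolding code_at_def using P k by (intro exI[of _ as] exI[of _ "ys @ bs"]) simp
  show "code_at P (k + length xs) ys"
    unfolding code_at_def using P k by (intro exI[of _ "as @ xs"] exI[of _ bs]) simp
qed

lemma code_at_ConsD:
  assumes "code_at P k (x # xs)"
  shows "k < length P" and "P ! k = x" and "code_at P (Suc k) xs"
  using code_at_appendD(2)[of P k "[x]" xs] assms by (auto simp: code_at_def)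

text \<open>In \<open>machine\<close>, \<open>B\<close> bounds the contents of the registers and \<open>L\<close> the extent of the memory.
  Since \<open>B \<le> 2 ^ w\<close>, arithmetic on contents below \<open>B\<close> is exact.\<close>

locale machine =
  fixes w n :: nat and I :: "'a access" and B L :: nat
  assumes B_le: "B \<le> 2 ^ w"
begin

definition fits :: "config \<Rightarrow> bool" where
  "fits c \<longleftrightarrow> (\<forall>r. reg c r < B) \<and> extent c \<le> L"

text \<open>\<open>fits\<close> is demanded of every configuration, because the space charged for a
  register is a maximum over the whole run.\<close>

fun reaches :: "'a ram_program \<Rightarrow> nat \<Rightarrow> config \<Rightarrow> config \<Rightarrow> bool" where
  "reaches P 0 c c' \<longleftrightarrow> fits c \<and> c' = c"
| "reaches P (Suc t) c c' \<longleftrightarrow>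
     fits c \<and> (\<exists>c1. step w n I P c = Some c1 \<and> reaches P t c1 c')"

lemma reaches_fits: "reaches P t c c' \<Longrightarrow> fits c'"
  by (induction t arbitrary: c) auto

lemma reaches_trans: "reaches P t c c' \<Longrightarrow> reaches P t' c' c'' \<Longrightarrow> reaches P (t + t') c c''"
  by (induction t arbitrary: c) auto

lemma reaches_path:
  assumes "reaches P t c c'"
  shows "\<exists>\<gamma>. \<gamma> 0 = c \<and> \<gamma> t = c' \<and> (\<forall>i<t. step w n I P (\<gamma> i) = Some (\<gamma> (Suc i)))
    \<and> (\<forall>i\<le>t. fits (\<gamma> i))"
  using assms
proof (induction t arbitrary: c)
  case 0
  then show ?case by auto
next
  case (Suc t)
  then obtain c1 where c1: "fits c" "step w n I P c = Some c1" "reaches P t c1 c'"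
    by auto
  from Suc.IH[OF c1(3)] obtain \<gamma> where \<gamma>: "\<gamma> 0 = c1" "\<gamma> t = c'"
    "\<forall>i<t. step w n I P (\<gamma> i) = Some (\<gamma> (Suc i))" "\<forall>i\<le>t. fits (\<gamma> i)"
    by blast
  show ?case
    using \<gamma> c1 by (intro exI[of _ "case_nat c \<gamma>"]) (auto split: nat.split simp: less_Suc_eq_0_disj le_Suc_eq Suc_le_eq)
qed

text \<open>The arguments are the registers, the memory and the invocations of user procedures.\<close>

type_synonym assertion = "(nat \<Rightarrow> nat) \<Rightarrow> (nat \<Rightarrow> bool) \<Rightarrow> nat event list \<Rightarrow> bool"

text \<open>Total correctness with a time bound, as a predicate transformer, so that a postcondition
  may itself be a \<open>run\<close>. The surrounding program and the address of the code are
  arbitrary.\<close>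

definition run :: "'a com \<Rightarrow> nat \<Rightarrow> assertion \<Rightarrow> assertion" where
  "run C t Q R M es \<longleftrightarrow>
     (\<forall>P k c. code_at P k (compile k C) \<and> pc c = k \<and> reg c = R \<and> mem c = M \<and> calls c = es \<and> fits c
       \<longrightarrow> (\<exists>t'\<le>t. \<exists>c'. reaches P t' c c' \<and> pc c' = k + code_size C
              \<and> Q (reg c') (mem c') (calls c')))"

lemma run_mono:
  assumes "run C t Q R M es" "t \<le> t'" "\<And>R M es. Q R M es \<Longrightarrow> Q' R M es"
  shows "run C t' Q' R M es"
  unfolding run_def
proof (intro allI impI, elim conjE)
  fix P k c
  assume "code_at P k (compile k C)" "pc c = k" "reg c = R" "mem c = M" "calls c = es" "fits c"
  with assms(1) obtain s c' where "s \<le> t" "reaches P s c c'" "pc c' = k + code_size C"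
    "Q (reg c') (mem c') (calls c')"
    unfolding run_def by blast
  with assms(2,3) show "\<exists>t''\<le>t'. \<exists>c'. reaches P t'' c c' \<and> pc c' = k + code_size C
      \<and> Q' (reg c') (mem c') (calls c')"
    by (meson order_trans)
qed

lemma run_Skip: "Q R M es \<Longrightarrow> run Skip 0 Q R M es"
  by (auto simp: run_def)

lemma run_Seq:
  assumes "run C t (run D t' Q) R M es"
  shows "run (C ;; D) (t + t') Q R M es"
  unfolding run_def
proof (intro allI impI, elim conjE)
  fix P k c
  assume code: "code_at P k (compile k (C ;; D))"
    and c: "pc c = k" "reg c = R" "mem c = M" "calls c = es" "fits c"
  from code have C: "code_at P k (compile k C)"
    and D: "code_at P (k + code_size C) (compile (k + code_size C) D)"
    using code_at_appendD by fastforce+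
  from assms C c obtain s c' where 1: "s \<le> t" "reaches P s c c'" "pc c' = k + code_size C"
    "run D t' Q (reg c') (mem c') (calls c')"
    unfolding run_def[of C] by blast
  with D obtain s' c'' where 2: "s' \<le> t'" "reaches P s' c' c''"
    "pc c'' = k + code_size C + code_size D" "Q (reg c'') (mem c'') (calls c'')"
    unfolding run_def[of D] using reaches_fits by blast
  show "\<exists>t''\<le>t + t'. \<exists>c'. reaches P t'' c c' \<and> pc c' = k + code_size (C ;; D)
      \<and> Q (reg c') (mem c') (calls c')"
    using 1 2 reaches_trans[OF 1(2) 2(2)]
    by (intro exI[of _ "s + s'"] conjI exI[of _ c'']) auto
qed

lemma step_jump_if:
  assumes "pc c < length P" "P ! pc c = jump_if b k"
  shows "step w n I P c = Some (c\<lparr>pc := if holds b (reg c) then k else Suc (pc c)\<rparr>)"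
  using assms by (cases b) (auto simp: step_def)

lemma step_jump:
  assumes "pc c < length P" "P ! pc c = Jump k"
  shows "step w n I P c = Some (c\<lparr>pc := k\<rparr>)"
  using assms by (auto simp: step_def)

lemma fits_pc [simp]: "fits (c\<lparr>pc := k\<rparr>) = fits c"
  by (simp add: fits_def)

lemma run_If:
  assumes "holds b R \<Longrightarrow> run C t Q R M es" "\<not> holds b R \<Longrightarrow> run D t Q R M es"
  shows "run (If_then_else b C D) (t + 2) Q R M es"
  unfolding run_def
proof (intro allI impI, elim conjE)
  fix P k c
  assume code: "code_at P k (compile k (If_then_else b C D))"
    and c: "pc c = k" "reg c = R" "mem c = M" "calls c = es" "fits c"
  note code1 = code_at_ConsD[OF code[unfolded compile.simps]]
  note codeD = code_at_appendD(1)[OF code1(3)]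
  note code2 = code_at_ConsD[OF code_at_appendD(2)[OF code1(3)]]
  have codeC: "code_at P (k + code_size D + 2) (compile (k + code_size D + 2) C)"
    using code2(3) by (simp add: add.commute)
  let ?c = "c\<lparr>pc := if holds b R then k + code_size D + 2 else Suc k\<rparr>"
  have step: "step w n I P c = Some ?c"
    using step_jump_if code1 c by metis
  show "\<exists>t'\<le>t + 2. \<exists>c'. reaches P t' c c' \<and> pc c' = k + code_size (If_then_else b C D)
      \<and> Q (reg c') (mem c') (calls c')"
  proof (cases "holds b R")
    case True
    then have "run C t Q R M es" by (rule assms)
    with codeC c True obtain s c' where "s \<le> t" "reaches P s ?c c'"
      "pc c' = k + code_size D + 2 + code_size C" "Q (reg c') (mem c') (calls c')"
      unfolding run_def by (elim allE[of _ P] allE[of _ "k + code_size D + 2"] allE[of _ ?c]) auto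
    then show ?thesis
      using step c by (intro exI[of _ "Suc s"] conjI exI[of _ c']) auto
  next
    case False
    then have "run D t Q R M es" by (rule assms)
    with codeD c False obtain s c' where 1: "s \<le> t" "reaches P s ?c c'"
      "pc c' = Suc k + code_size D" "Q (reg c') (mem c') (calls c')"
      unfolding run_def by (elim allE[of _ P] allE[of _ "Suc k"] allE[of _ ?c]) auto
    let ?c' = "c'\<lparr>pc := k + code_size C + code_size D + 2\<rparr>"
    have "step w n I P c' = Some ?c'"
      using code2 1 by (intro step_jump) auto
    then have "reaches P 1 c' ?c'"
      using 1(2) reaches_fits by auto
    from reaches_trans[OF 1(2) this] step c have "reaches P (Suc (s + 1)) c ?c'"
      by auto
    then show ?thesis
      using 1 by (intro exI[of _ "Suc (s + 1)"] conjI exI[of _ ?c']) auto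
  qed
qed

text \<open>The index of the invariant is the variant. A round costs the body, the test and the jump
  back; the failing test costs two steps, as it falls through to the exit jump.\<close>

lemma run_While:
  assumes "J k R M es"
    and body: "\<And>k R M es. J k R M es \<Longrightarrow> holds b R \<Longrightarrow> run C t (\<lambda>R M es. \<exists>k'<k. J k' R M es) R M es"
  shows "run (While b C) (k * (t + 2) + 2) (\<lambda>R M es. \<exists>k. J k R M es \<and> \<not> holds b R) R M es"
  using assms(1)
proof (induction k arbitrary: R M es rule: less_induct)
  case (less m)
  show ?case
    unfolding run_def
  proof (intro allI impI, elim conjE)
    fix P k c
    assume code: "code_at P k (compile k (While b C))"
      and c: "pc c = k" "reg c = R" "mem c = M" "calls c = es" "fits c"
    note code1 = code_at_ConsD[OF code[unfolded compile.simps append.simps]]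
    note code2 = code_at_ConsD[OF code1(3)]
    have codeC: "code_at P (k + 2) (compile (k + 2) C)"
      and code3: "code_at P (k + 2 + code_size C) [Jump k]"
      using code_at_appendD[OF code2(3)] by simp_all
    let ?c = "c\<lparr>pc := if holds b R then k + 2 else Suc k\<rparr>"
    have step: "step w n I P c = Some ?c"
      using step_jump_if code1 c by metis
    show "\<exists>t'\<le>m * (t + 2) + 2. \<exists>c'. reaches P t' c c' \<and> pc c' = k + code_size (While b C)
        \<and> (\<exists>k. J k (reg c') (mem c') (calls c') \<and> \<not> holds b (reg c'))"
    proof (cases "holds b R")
      case False
      let ?c' = "c\<lparr>pc := k + code_size C + 3\<rparr>"
      have "step w n I P ?c = Some ?c'"
        using code2 False by (subst step_jump) auto
      then have "reaches P 2 c ?c'"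
        using step c by (auto simp: numeral_2_eq_2)
      then show ?thesis
        using less.prems c False by (intro exI[of _ "2::nat"] conjI exI[of _ ?c'] exI[of _ m]) auto
    next
      case True
      from body[OF less.prems True] codeC c True obtain s c' m' where 1: "s \<le> t" "reaches P s ?c c'"
        "pc c' = k + 2 + code_size C" "m' < m" "J m' (reg c') (mem c') (calls c')"
        unfolding run_def by (elim allE[of _ P] allE[of _ "k + 2"] allE[of _ ?c]) auto
      let ?c' = "c'\<lparr>pc := k\<rparr>"
      have "step w n I P c' = Some ?c'"
        using code_at_ConsD[OF code3] 1 by (intro step_jump) auto
      then have 2: "reaches P 1 c' ?c'"
        using 1(2) reaches_fits by auto
      from reaches_trans[OF 1(2) this] step c have 3: "reaches P (Suc (s + 1)) c ?c'"
        by auto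
      have "run (While b C) (m' * (t + 2) + 2) (\<lambda>R M es. \<exists>k. J k R M es \<and> \<not> holds b R)
          (reg ?c') (mem ?c') (calls ?c')"
        using less.IH[OF 1(4)] 1(5) by simp
      moreover have "fits ?c'" "pc ?c' = k"
        using 1(2) reaches_fits by auto
      ultimately obtain s' c'' where 4: "s' \<le> m' * (t + 2) + 2" "reaches P s' ?c' c''"
        "pc c'' = k + code_size (While b C)"
        "\<exists>k. J k (reg c'') (mem c'') (calls c'') \<and> \<not> holds b (reg c'')"
        unfolding run_def using code by blast
      have "Suc m' * (t + 2) \<le> m * (t + 2)"
        using 1(4) by (intro mult_le_mono1) simp
      then have "Suc (s + 1) + s' \<le> m * (t + 2) + 2"
        using 1(1) 4(1) by simp
      then show ?thesis
        using reaches_trans[OF 3 4(2)] 4 by blast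
    qed
  qed
qed

text \<open>Weakest preconditions of loop-free commands, strengthened so that all arithmetic is exact;
  instructions that the program does not use are given the precondition \<open>False\<close>.\<close>

fun pre_instr :: "('a, nat) instr \<Rightarrow> assertion \<Rightarrow> assertion" where
  "pre_instr (Const r k) Q R M es \<longleftrightarrow> k < B \<and> Q (R(r := k)) M es"
| "pre_instr (Move r s) Q R M es \<longleftrightarrow> Q (R(r := R s)) M es"
| "pre_instr (Op Add r s t) Q R M es \<longleftrightarrow> R s + R t < B \<and> Q (R(r := R s + R t)) M es"
| "pre_instr (Op Sub r s t) Q R M es \<longleftrightarrow> R t \<le> R s \<and> Q (R(r := R s - R t)) M es"
| "pre_instr (Op Mul r s t) Q R M es \<longleftrightarrow> R s * R t < B \<and> Q (R(r := R s * R t)) M es"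
| "pre_instr (Op Div r s t) Q R M es \<longleftrightarrow> Q (R(r := R s div R t)) M es"
| "pre_instr (Load r a l) Q R M es \<longleftrightarrow> R l \<le> w \<and> R a + R l \<le> L \<and> load_bits M (R a) (R l) < B
     \<and> Q (R(r := load_bits M (R a) (R l))) M es"
| "pre_instr (Store a l r) Q R M es \<longleftrightarrow> R l \<le> w \<and> R a + R l \<le> L
     \<and> Q R (store_bits M (R a) (R l) (R r)) es"
| "pre_instr (Get_n r) Q R M es \<longleftrightarrow> n < B \<and> Q (R(r := n)) M es"
| "pre_instr (Get_deg a r u) Q R M es \<longleftrightarrow> R u \<in> {1..n} \<and> deg I a (R u) < B
     \<and> Q (R(r := deg I a (R u))) M es"
| "pre_instr (Get_head a r u i) Q R M es \<longleftrightarrow> R u \<in> {1..n} \<and> R i < deg I a (R u)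
     \<and> head I a (R u) (R i) < B \<and> Q (R(r := head I a (R u) (R i))) M es"
| "pre_instr (Get_mate a r u i) Q R M es \<longleftrightarrow> R u \<in> {1..n} \<and> R i < deg I a (R u)
     \<and> mate I a (R u) (R i) < B \<and> Q (R(r := mate I a (R u) (R i))) M es"
| "pre_instr (Call e) Q R M es \<longleftrightarrow> Q R M (es @ [map_event R e])"
| "pre_instr _ Q R M es \<longleftrightarrow> False"

fun pre :: "'a com \<Rightarrow> assertion \<Rightarrow> assertion" where
  "pre Skip Q R M es \<longleftrightarrow> Q R M es"
| "pre (Do i) Q R M es \<longleftrightarrow> pre_instr i Q R M es"
| "pre (C ;; D) Q R M es \<longleftrightarrow> pre C (pre D Q) R M es"
| "pre (If_then_else b C D) Q R M es \<longleftrightarrow> (if holds b R then pre C Q R M es else pre D Q R M es)"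
| "pre (While b C) Q R M es \<longleftrightarrow> False"

lemma pre_instr_mono:
  assumes "pre_instr i Q R M es" "\<And>R M es. Q R M es \<Longrightarrow> Q' R M es"
  shows "pre_instr i Q' R M es"
  using assms by (induction i Q R M es rule: pre_instr.induct) auto

lemma pre_mono:
  assumes "pre C Q R M es" "\<And>R M es. Q R M es \<Longrightarrow> Q' R M es"
  shows "pre C Q' R M es"
  using assms
proof (induction C arbitrary: Q Q' R M es)
  case (Seq C1 C2)
  then show ?case by (metis pre.simps(3))
qed (auto intro: pre_instr_mono split: if_splits)

lemma take_bit_less: "x < B \<Longrightarrow> take_bit w x = x"
  using B_le by (simp add: take_bit_nat_eq_self)

lemma exec_pre_instr:
  assumes "pre_instr i Q (reg c) (mem c) (calls c)" "fits c"
  shows "\<exists>c'. exec w n I i c = Some c' \<and> fits c' \<and> pc c' = Suc (pc c)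
    \<and> Q (reg c') (mem c') (calls c')"
proof -
  have sub: "take_bit w (x + 2 ^ w - y) = x - y" if "y \<le> x" "x < B" for x y :: nat
  proof -
    have "x + 2 ^ w - y = (x - y) + 2 ^ w"
      using that by simp
    moreover have "x - y < 2 ^ w"
      using that B_le by linarith
    ultimately show ?thesis
      by (metis mod_add_self2 mod_less take_bit_eq_mod)
  qed
  have lt: "reg c r < B" for r
    using assms(2) by (simp add: fits_def)
  have div: "reg c s div k < B" for s k
    using lt[of s] div_le_dividend[of "reg c s" k] by linarith
  have sub': "reg c s - k < B" for s k
    using lt[of s] by linarith
  have put: "fits (put r x c)" if "x < B" for r x
    using that assms(2) by (simp add: fits_def put_def)
  note [simp] = lt div sub' sub put
  show ?thesis
  proof (cases i)
    case (Op f r s t)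
    then show ?thesis
      using assms(1) by (cases f) (auto simp: take_bit_less, auto simp: put_def)
  qed (use assms in \<open>auto simp: take_bit_less fits_def put_def\<close>)
qed

lemma run_pre:
  assumes "pre C Q R M es"
  shows "run C (code_size C) Q R M es"
  using assms
proof (induction C arbitrary: Q R M es)
  case Skip
  then show ?case by (auto intro: run_Skip)
next
  case (Do i)
  show ?case
    unfolding run_def
  proof (intro allI impI, elim conjE)
    fix P k c
    assume code: "code_at P k (compile k (Do i))"
      and c: "pc c = k" "reg c = R" "mem c = M" "calls c = es" "fits c"
    from Do c have "\<exists>c'. exec w n I i c = Some c' \<and> fits c' \<and> pc c' = Suc (pc c)
        \<and> Q (reg c') (mem c') (calls c')"
      by (intro exec_pre_instr) auto
    then obtain c' where c': "exec w n I i c = Some c'" "fits c'" "pc c' = Suc k"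
      "Q (reg c') (mem c') (calls c')"
      using c by auto
    have "step w n I P c = Some c'"
      using code_at_ConsD[OF code[unfolded compile.simps]] c c' by (simp add: step_def)
    then show "\<exists>t'\<le>code_size (Do i). \<exists>c'. reaches P t' c c' \<and> pc c' = k + code_size (Do i)
        \<and> Q (reg c') (mem c') (calls c')"
      using c c' by (intro exI[of _ 1] conjI exI[of _ c']) auto
  qed
next
  case (Seq C D)
  then have "run C (code_size C) (run D (code_size D) Q) R M es"
    by (simp add: pre_mono)
  then show ?case
    by (simp add: run_Seq)
next
  case (If_then_else b C D)
  have "run (If_then_else b C D) (code_size C + code_size D + 2) Q R M es"
  proof (rule run_If)
    assume "holds b R"
    with If_then_else show "run C (code_size C + code_size D) Q R M es"
      by (intro run_mono[OF If_then_else.IH(1)]) auto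
  next
    assume "\<not> holds b R"
    with If_then_else show "run D (code_size C + code_size D) Q R M es"
      by (intro run_mono[OF If_then_else.IH(2)]) auto
  qed
  then show ?case by simp
qed auto

end

section \<open>Fields of the memory\<close>

lemma load_bits_eq_horner_sum: "load_bits M a l = horner_sum of_bool 2 (map (\<lambda>i. M (a + i)) [0..<l])"
  by (simp add: load_bits_def horner_sum_eq_sum atLeast0LessThan)

lemma bit_load_bits: "bit (load_bits M a l) i \<longleftrightarrow> i < l \<and> M (a + i)"
  by (auto simp: load_bits_eq_horner_sum bit_horner_sum_bit_iff)

lemma load_bits_less: "load_bits M a l < 2 ^ l"
proof -
  have "take_bit l (load_bits M a l) = load_bits M a l"
    by (auto intro!: bit_eqI simp: bit_take_bit_iff bit_load_bits)
  then show ?thesis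
    by (simp add: take_bit_nat_eq_self_iff)
qed

lemma load_bits_cong: "(\<And>b. a \<le> b \<Longrightarrow> b < a + l \<Longrightarrow> M b = M' b) \<Longrightarrow> load_bits M a l = load_bits M' a l"
  by (auto simp: load_bits_def intro!: sum.cong)

lemma load_store_same:
  assumes "x < 2 ^ l"
  shows "load_bits (store_bits M a l x) a l = x"
proof -
  have "take_bit l x = x"
    using assms by (simp add: take_bit_nat_eq_self)
  then have "i < l" if "bit x i" for i
    using that by (metis bit_take_bit_iff)
  then show ?thesis
    by (intro bit_eqI) (auto simp: bit_load_bits store_bits_def)
qed

lemma load_store_disjoint:
  "a + l \<le> a' \<or> a' + l' \<le> a \<Longrightarrow> load_bits (store_bits M a' l' x) a l = load_bits M a l"
  by (rule load_bits_cong) (auto simp: store_bits_def)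

lemma load_bits_1: "load_bits M a (Suc 0) = of_bool (M a)"
  by (simp add: load_bits_def)

lemma store_bits_outside: "b < a \<or> a + l \<le> b \<Longrightarrow> store_bits M a l x b = M b"
  by (auto simp: store_bits_def)

lemma store_bits_1: "store_bits M a (Suc 0) x = M(a := odd x)"
  by (auto simp: store_bits_def fun_eq_iff bit_0 le_less_Suc_eq)

section \<open>A stack of numbers from small ranges\<close>

text \<open>An entry \<open>(d, y)\<close> with \<open>y < d - 1\<close> may take \<open>2 * d / 5\<close> bits. For \<open>d \<ge> 8\<close> a field of its
  own suffices. For \<open>d < 8\<close> the entry is a digit to base \<open>d - 1\<close> that goes into a buffer \<open>x d\<close> for
  the \<open>c d\<close> most recent such digits; as soon as there are five of them, they are moved to the
  stack of fields as a number of \<open>2 * d\<close> bits, which is possible since \<open>(d - 1) ^ 5 \<le> 4 ^ d\<close>.\<close>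

type_synonym pile = "(nat \<Rightarrow> nat) \<times> (nat \<Rightarrow> nat) \<times> (nat \<times> nat) list"

fun add_entry :: "nat \<Rightarrow> nat \<times> nat \<Rightarrow> pile \<Rightarrow> pile" where
  "add_entry W (d, y) (x, c, fs) =
     (if d < 8 then
        if c d = 4 then (x(d := 0), c(d := 0), (2 * d, x d * (d - 1) + y) # fs)
        else (x(d := x d * (d - 1) + y), c(d := Suc (c d)), fs)
      else (x, c, (min (2 * d div 5) W, y) # fs))"

text \<open>The pile depends on the entries present alone, not on past pushes and pops; a pop thus
  has to undo \<open>add_entry\<close> exactly.\<close>

definition pile :: "nat \<Rightarrow> (nat \<times> nat) list \<Rightarrow> pile" where
  "pile W es = foldr (add_entry W) es (\<lambda>_. 0, \<lambda>_. 0, [])"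

lemma pile_Nil: "pile W [] = (\<lambda>_. 0, \<lambda>_. 0, [])"
  and pile_Cons: "pile W (e # es) = add_entry W e (pile W es)"
  by (simp_all add: pile_def)

definition valid_entry :: "nat \<Rightarrow> nat \<times> nat \<Rightarrow> bool" where
  "valid_entry W e \<longleftrightarrow> 2 \<le> fst e \<and> snd e < fst e - 1 \<and> snd e < 2 ^ W"

lemma five_digits:
  assumes "2 \<le> d" "d < 8" "x < (d - 1) ^ 4" "y < d - 1"
  shows "x * (d - 1) + y < (2::nat) ^ (2 * d)"
proof -
  have "x * (d - 1) + y < Suc x * (d - 1)"
    using assms(4) by simp
  also have "\<dots> \<le> (d - 1) ^ 4 * (d - 1)"
    using assms(3) by (intro mult_le_mono1) simp
  also have "\<dots> = (d - 1) ^ 5"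
    by (simp add: eval_nat_numeral)
  also have "\<dots> \<le> 2 ^ (2 * d)"
  proof -
    \<comment> \<open>Six numerical checks; besides the equality at \<open>d = 5\<close>, the
      tightest is \<open>243 \<le> 256\<close> at \<open>d = 4\<close>.\<close>
    have "d \<in> {2, 3, 4, 5, 6, 7}"
      using assms(1,2) by auto
    then show ?thesis by auto
  qed
  finally show ?thesis .
qed

lemma range_le_power_of_2:
  assumes "8 \<le> d"
  shows "d - 1 \<le> 2 ^ (2 * d div 5)"
proof -
  \<comment> \<open>With \<open>k = 2 * d div 5\<close> one has
    \<open>2 * (d - 1) \<le> 5 * k + 2\<close>. The surplus \<open>1\<close> on the right is
    harmless because \<open>2 * (d - 1)\<close> is even, and it is needed at \<open>k = 3\<close>,
    where both sides are 17.\<close>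
  have "5 * k + 2 \<le> 2 * 2 ^ k + (1::nat)" if "3 \<le> k" for k
    using that by (induction k rule: dec_induct) auto
  from this[of "2 * d div 5"] assms show ?thesis
    by linarith
qed

text \<open>A buffer is a number with \<open>c d\<close> digits to base \<open>d - 1\<close>. The
  \<open>14\<close> is the length \<open>2 * d\<close> of a block for the largest buffered
  \<open>d\<close>, namely 7.\<close>

lemma pile_bounds:
  assumes "\<forall>e\<in>set es. valid_entry W e" "pile W es = (x, c, fs)"
  shows "(\<forall>d. c d < 5 \<and> x d < (d - 1) ^ c d) \<and> (\<forall>(l, y)\<in>set fs. y < 2 ^ l \<and> l \<le> max 14 W)"
  using assms
proof (induction es arbitrary: x c fs)
  case Nil
  then show ?case by (auto simp: pile_Nil)
next
  case (Cons e es)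
  obtain d y where e: "e = (d, y)" by fastforce
  obtain x' c' fs' where p: "pile W es = (x', c', fs')" by (metis prod_cases3)
  have valid: "2 \<le> d" "y < d - 1" "y < 2 ^ W"
    using Cons.prems(1) by (auto simp: valid_entry_def e)
  from Cons p have IH: "\<And>d. c' d < 5" "\<And>d. x' d < (d - 1) ^ c' d"
    "\<forall>(l, y)\<in>set fs'. y < 2 ^ l \<and> l \<le> max 14 W"
    by auto
  have "x' d * (d - 1) + y < Suc (x' d) * (d - 1)"
    using valid by simp
  also have "\<dots> \<le> (d - 1) ^ c' d * (d - 1)"
    using IH(2)[of d] by (intro mult_le_mono1) simp
  finally have digit: "x' d * (d - 1) + y < (d - 1) ^ Suc (c' d)"
    by (simp add: mult.commute)
  consider "d < 8" "c' d = 4" | "d < 8" "c' d \<noteq> 4" | "8 \<le> d" by linarith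
  then show ?case
  proof cases
    case 1
    then have "x' d * (d - 1) + y < 2 ^ (2 * d)"
      using five_digits[OF valid(1) 1(1)] IH(2)[of d] valid(2) by simp
    with 1 Cons.prems(2) IH show ?thesis
      by (auto simp: pile_Cons e p)
  next
    case 2
    then have "Suc (c' d) < 5"
      using IH(1)[of d] by simp
    with 2 Cons.prems(2) IH digit show ?thesis
      by (auto simp: pile_Cons e p)
  next
    case 3
    then have "y < 2 ^ min (2 * d div 5) W"
      using range_le_power_of_2[of d] valid by (auto simp: min_def)
    with 3 Cons.prems(2) IH show ?thesis
      by (auto simp: pile_Cons e p)
  qed
qed

text \<open>Amortization, scaled by 5 to stay in the integers: each digit brings a credit of
  \<open>2 * d\<close>, held in the second sum while the digit is in its buffer. The fifth digit
  releases the \<open>8 * d\<close> of the other four, which with its own \<open>2 * d\<close> pays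
  for a field of \<open>2 * d\<close> bits.\<close>

lemma pile_size:
  assumes "\<forall>e\<in>set es. valid_entry W e" "pile W es = (x, c, fs)"
  shows "5 * sum_list (map fst fs) + 2 * (\<Sum>d<8. d * c d) \<le> 2 * sum_list (map fst es)"
  using assms
proof (induction es arbitrary: x c fs)
  case Nil
  then show ?case by (auto simp: pile_Nil)
next
  case (Cons e es)
  obtain d y where e: "e = (d, y)" by fastforce
  obtain x' c' fs' where p: "pile W es = (x', c', fs')" by (metis prod_cases3)
  from Cons p have IH: "5 * sum_list (map fst fs') + 2 * (\<Sum>d<8. d * c' d) \<le> 2 * sum_list (map fst es)"
    by auto
  have upd: "(\<Sum>i<8. i * (c'(d := k)) i) + d * c' d = (\<Sum>i<8. i * c' i) + d * k" if "d < 8" for k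
    using that by (subst (1 2) sum.remove[of _ d]) auto
  have field: "5 * (min (2 * d div 5) W) \<le> 2 * d"
    by linarith
  consider "d < 8" "c' d = 4" | "d < 8" "c' d \<noteq> 4" | "\<not> d < 8" by blast
  then show ?case
  proof cases
    case 1
    with Cons.prems IH upd[of 0] show ?thesis
      by (auto simp: pile_Cons e p)
  next
    case 2
    with Cons.prems IH upd[of "Suc (c' d)"] show ?thesis
      by (auto simp: pile_Cons e p)
  next
    case 3
    with Cons.prems IH field show ?thesis
      by (auto simp: pile_Cons e p simp del: min_less_iff_conj)
  qed
qed

text \<open>The buffers are in the first 256 bits, the fields between \<open>base\<close> and \<open>sp\<close>.\<close>

fun fields :: "(nat \<Rightarrow> bool) \<Rightarrow> nat \<Rightarrow> nat \<Rightarrow> (nat \<times> nat) list \<Rightarrow> bool" where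
  "fields M base sp [] \<longleftrightarrow> sp = base"
| "fields M base sp ((l, y) # fs) \<longleftrightarrow>
     base + l \<le> sp \<and> load_bits M (sp - l) l = y \<and> fields M base (sp - l) fs"

lemma fields_sp: "fields M base sp fs \<Longrightarrow> sp = base + sum_list (map fst fs)"
  by (induction M base sp fs rule: fields.induct) auto

lemma fields_cong:
  "fields M base sp fs \<Longrightarrow> (\<And>b. base \<le> b \<Longrightarrow> b < sp \<Longrightarrow> M' b = M b) \<Longrightarrow> fields M' base sp fs"
proof (induction M base sp fs rule: fields.induct)
  case (2 M base sp l y fs)
  then have "load_bits M' (sp - l) l = load_bits M (sp - l) l"
    by (intro load_bits_cong) auto
  with 2 show ?case by auto
qed auto

text \<open>Sixteen bits suffice, since even five digits stay below \<open>2 ^ 14\<close>; eight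
  records of 32 bits fill the first 256 bits.\<close>

definition buffers :: "(nat \<Rightarrow> bool) \<Rightarrow> (nat \<Rightarrow> nat) \<Rightarrow> (nat \<Rightarrow> nat) \<Rightarrow> bool" where
  "buffers M x c \<longleftrightarrow> (\<forall>d<8. load_bits M (d * 32) 16 = x d \<and> load_bits M (d * 32 + 16) 16 = c d)"

lemma buffers_cong: "buffers M x c \<Longrightarrow> (\<And>b. b < 256 \<Longrightarrow> M' b = M b) \<Longrightarrow> buffers M' x c"
proof -
  assume M: "buffers M x c" and M': "\<And>b. b < 256 \<Longrightarrow> M' b = M b"
  have "load_bits M' (d * 32) 16 = load_bits M (d * 32) 16"
    "load_bits M' (d * 32 + 16) 16 = load_bits M (d * 32 + 16) 16" if "d < 8" for d
    using that M' by (auto intro!: load_bits_cong)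
  with M show ?thesis by (simp add: buffers_def)
qed

lemma buffers_store:
  assumes "buffers M x c" "d < 8" "y < 2 ^ 16" "k < 2 ^ 16"
  shows "buffers (store_bits (store_bits M (d * 32) 16 y) (d * 32 + 16) 16 k) (x(d := y)) (c(d := k))"
  unfolding buffers_def
proof (intro allI impI)
  fix i :: nat
  assume "i < 8"
  have "i = d \<or> Suc i \<le> d \<or> Suc d \<le> i" by linarith
  then have "i = d \<or> i * 32 + 32 \<le> d * 32 \<or> d * 32 + 32 \<le> i * 32" by linarith
  then show "load_bits (store_bits (store_bits M (d * 32) 16 y) (d * 32 + 16) 16 k) (i * 32) 16
        = (x(d := y)) i \<and>
      load_bits (store_bits (store_bits M (d * 32) 16 y) (d * 32 + 16) 16 k) (i * 32 + 16) 16
        = (c(d := k)) i"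
    using assms \<open>i < 8\<close> by (auto simp: load_store_same load_store_disjoint buffers_def)
qed

definition stacked :: "nat \<Rightarrow> nat \<Rightarrow> (nat \<Rightarrow> bool) \<Rightarrow> nat \<Rightarrow> (nat \<times> nat) list \<Rightarrow> bool" where
  "stacked W base M sp es \<longleftrightarrow>
     (case pile W es of (x, c, fs) \<Rightarrow> buffers M x c \<and> fields M base sp fs)"

lemma stacked_cong:
  assumes "stacked W base M sp es" "\<And>b. b < 256 \<or> base \<le> b \<and> b < sp \<Longrightarrow> M' b = M b"
  shows "stacked W base M' sp es"
  using assms by (auto simp: stacked_def intro: buffers_cong fields_cong split: prod.splits)

section \<open>Depth-first search with adjacency arrays\<close>

text \<open>For an undirected graph both \<open>outs\<close> and \<open>ins\<close> are its only kind of adjacency array, and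
  \<open>mult = 1\<close>; for a directed one \<open>mult = 2\<close>, so that in both cases the numbers \<open>width u\<close> below
  add up to \<open>2 * m\<close>.\<close>

locale dfs_graph =
  fixes n :: nat and I :: "'a access" and E :: "(nat \<times> nat) set" and outs ins :: 'a
    and mult m :: nat
  assumes n_pos: "1 \<le> n"
    and edges: "E \<subseteq> {1..n} \<times> {1..n}"
    and heads_outs: "\<And>u. u \<in> {1..n} \<Longrightarrow> bij_betw (head I outs u) {..<deg I outs u} {v. (u, v) \<in> E}"
    and heads_ins: "\<And>u. u \<in> {1..n} \<Longrightarrow> bij_betw (head I ins u) {..<deg I ins u} {v. (v, u) \<in> E}"
    and mate_outs: "\<And>u i. u \<in> {1..n} \<Longrightarrow> i < deg I outs u \<Longrightarrow>
      mate I outs u i < deg I ins (head I outs u i)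
      \<and> head I ins (head I outs u i) (mate I outs u i) = u"
    and mate_ins: "\<And>u i. u \<in> {1..n} \<Longrightarrow> i < deg I ins u \<Longrightarrow>
      mate I ins u i < deg I outs (head I ins u i)
      \<and> head I outs (head I ins u i) (mate I ins u i) = u"
    and mult: "mult = 1 \<and> outs = ins \<or> mult = 2"
    and m: "mult * card E = 2 * m"
begin

abbreviation "odeg \<equiv> deg I outs"
abbreviation "ideg \<equiv> deg I ins"
abbreviation "ohead \<equiv> head I outs"
abbreviation "ihead \<equiv> head I ins"
abbreviation "omate \<equiv> mate I outs"
abbreviation "imate \<equiv> mate I ins"

lemma finite_E: "finite E"
  using edges finite_subset by blast

lemma ohead_edge: "u \<in> {1..n} \<Longrightarrow> i < odeg u \<Longrightarrow> (u, ohead u i) \<in> E"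
  using heads_outs[of u] by (auto simp: bij_betw_def)

lemma ohead_vertex: "u \<in> {1..n} \<Longrightarrow> i < odeg u \<Longrightarrow> ohead u i \<in> {1..n}"
  using ohead_edge edges by blast

lemma inj_ohead: "u \<in> {1..n} \<Longrightarrow> i < odeg u \<Longrightarrow> j < odeg u \<Longrightarrow> ohead u i = ohead u j \<Longrightarrow> i = j"
  using heads_outs[of u] by (auto simp: bij_betw_def inj_on_def)

text \<open>A mate is only required to lead back to the vertex; as there are no parallel edges,
  \<open>ohead u\<close> is injective, and this pins down the position as well.\<close>

lemma imate_omate:
  assumes "u \<in> {1..n}" "i < odeg u"
  shows "imate (ohead u i) (omate u i) = i"
  using mate_outs[OF assms] mate_ins[OF ohead_vertex[OF assms], of "omate u i"] inj_ohead[OF assms(1)] assms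
  by metis

lemma odeg_le: "u \<in> {1..n} \<Longrightarrow> odeg u \<le> n"
  using bij_betw_same_card[OF heads_outs, of u] card_mono[of "{1..n}" "{v. (u, v) \<in> E}"] edges
  by auto

lemma ideg_le: "u \<in> {1..n} \<Longrightarrow> ideg u \<le> n"
  using bij_betw_same_card[OF heads_ins, of u] card_mono[of "{1..n}" "{v. (v, u) \<in> E}"] edges
  by auto

lemma sum_ideg: "(\<Sum>u\<in>{1..n}. ideg u) = card E"
proof -
  have fin: "finite {v. (v, u) \<in> E}" for u
    using finite_subset[of "{v. (v, u) \<in> E}" "fst ` E"] finite_E by force
  have "(\<Sum>u\<in>{1..n}. ideg u) = (\<Sum>u\<in>{1..n}. card {v. (v, u) \<in> E})"
    using bij_betw_same_card[OF heads_ins] by (intro sum.cong) auto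
  also have "\<dots> = card (SIGMA u:{1..n}. {v. (v, u) \<in> E})"
    using fin by (subst card_SigmaI) auto
  also have "(SIGMA u:{1..n}. {v. (v, u) \<in> E}) = prod.swap ` E"
    using edges by force
  also have "card \<dots> = card E"
    by (simp add: card_image)
  finally show ?thesis .
qed

definition width :: "nat \<Rightarrow> nat" where
  "width u = mult * ideg u"

lemma sum_width:
  assumes "distinct S" "set S \<subseteq> {1..n}"
  shows "sum_list (map width S) \<le> 2 * m"
proof -
  have "sum_list (map width S) = (\<Sum>u\<in>set S. width u)"
    using assms(1) by (simp add: sum_list_distinct_conv_sum_set)
  also have "\<dots> \<le> (\<Sum>u\<in>{1..n}. width u)"
    using assms(2) by (intro sum_mono2) auto
  also have "\<dots> = 2 * m"
    using sum_ideg m by (simp add: width_def flip: sum_distrib_left)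
  finally show ?thesis .
qed

text \<open>\<open>nxt u\<close> is the number of edges explored from \<open>u\<close>.\<close>

definition unexplored :: "(nat \<Rightarrow> nat) \<Rightarrow> (nat \<times> nat) set" where
  "unexplored nxt = {(u, ohead u i) | u i. u \<in> {1..n} \<and> nxt u \<le> i \<and> i < odeg u}"

lemma unexplored_0: "unexplored (\<lambda>_. 0) = E"
proof
  show "unexplored (\<lambda>_. 0) \<subseteq> E"
    using ohead_edge by (auto simp: unexplored_def)
  show "E \<subseteq> unexplored (\<lambda>_. 0)"
  proof
    fix e
    assume e: "e \<in> E"
    then obtain u v where uv: "e = (u, v)" "u \<in> {1..n}"
      using edges by auto
    have "ohead u ` {..<odeg u} = {v. (u, v) \<in> E}"
      using heads_outs[OF uv(2)] by (simp add: bij_betw_def)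
    with e uv(1) have "v \<in> ohead u ` {..<odeg u}" by blast
    with uv show "e \<in> unexplored (\<lambda>_. 0)"
      by (auto simp: unexplored_def)
  qed
qed

lemma unexplored_subset: "unexplored nxt \<subseteq> E"
  using ohead_edge by (auto simp: unexplored_def)

lemma unexplored_next: "u \<in> {1..n} \<Longrightarrow> nxt u < odeg u \<Longrightarrow> (u, ohead u (nxt u)) \<in> unexplored nxt"
  by (auto simp: unexplored_def)

lemma unexplored_step:
  assumes "u \<in> {1..n}" "nxt u < odeg u"
  shows "unexplored (nxt(u := Suc (nxt u))) = unexplored nxt - {(u, ohead u (nxt u))}"
proof -
  have *: "(v = u \<longrightarrow> Suc (nxt u) \<le> i) \<and> (v \<noteq> u \<longrightarrow> nxt v \<le> i)
      \<longleftrightarrow> nxt v \<le> i \<and> (v, ohead v i) \<noteq> (u, ohead u (nxt u))"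
    if "v \<in> {1..n}" "i < odeg v" for v i
    using inj_ohead[of u i "nxt u"] assms that by (auto simp: Suc_le_eq le_less)
  show ?thesis
    unfolding unexplored_def using * by (fastforce split: if_splits)
qed

lemma unexplored_done: "odeg u \<le> nxt u \<Longrightarrow> u \<notin> fst ` unexplored nxt"
  by (auto simp: unexplored_def)

text \<open>\<open>nxt u = Suc q\<close>, because the tree edge counts as explored once the child is
  discovered. The counter of the first vertex is left free, so that the current vertex can
  advance.\<close>

fun tree_path :: "(nat \<Rightarrow> nat) \<Rightarrow> (nat \<Rightarrow> nat) \<Rightarrow> nat list \<Rightarrow> bool" where
  "tree_path nxt par (v # u # S) \<longleftrightarrow>
     (\<exists>q<odeg u. nxt u = Suc q \<and> v = ohead u q \<and> par v = omate u q) \<and> tree_path nxt par (u # S)"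
| "tree_path nxt par S \<longleftrightarrow> True"

lemma tree_path_cong:
  "tree_path nxt par S \<Longrightarrow> (\<And>u. u \<in> set (tl S) \<Longrightarrow> nxt' u = nxt u) \<Longrightarrow>
    (\<And>u. u \<in> set S \<Longrightarrow> par' u = par u) \<Longrightarrow> tree_path nxt' par' S"
proof (induction nxt par S rule: tree_path.induct)
  case (1 nxt par v u S)
  then show ?case by (cases S) auto
qed auto

text \<open>The vertices \<open>{1..r}\<close> have been stepped through as roots, \<open>S\<close> is the stack of gray vertices and
  \<open>Wh\<close> the set of white ones. \<open>par u\<close> is the position of the parent of \<open>u\<close> in the array \<open>ins\<close>
  of \<open>u\<close>; it is meaningless if \<open>u\<close> is a root.\<close>

definition dfs_state ::
    "nat \<Rightarrow> nat list \<Rightarrow> nat set \<Rightarrow> (nat \<Rightarrow> nat) \<Rightarrow> (nat \<Rightarrow> nat) \<Rightarrow> nat event list \<Rightarrow> bool" where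
  "dfs_state r S Wh nxt par es \<longleftrightarrow>
     dfs_reaches E [1..<n + 1] [r + 1..<n + 1] S Wh (unexplored nxt) es
     \<and> r \<le> n + 1 \<and> (S \<noteq> [] \<longrightarrow> last S = r \<and> r \<le> n)
     \<and> Wh \<subseteq> {1..n} \<and> set S \<subseteq> {1..n} - Wh \<and> distinct S
     \<and> (\<forall>u\<in>{1..n}. nxt u \<le> odeg u) \<and> (\<forall>u\<in>Wh. nxt u = 0) \<and> tree_path nxt par S"

text \<open>The variant of the main loop. A discovery lengthens the stack by one but frees the two
  units of a white vertex; every other step lowers one of the remaining terms. The initial value
  \<open>card E + 3 * n + 1\<close> makes the time linear.\<close>

definition potential :: "nat \<Rightarrow> nat list \<Rightarrow> nat set \<Rightarrow> (nat \<Rightarrow> nat) \<Rightarrow> nat" where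
  "potential r S Wh nxt = card (unexplored nxt) + 2 * card Wh + length S + (n + 1 - r)"

lemma dfs_state_init: "dfs_state 0 [] {1..n} (\<lambda>_. 0) (\<lambda>_. 0) []"
proof -
  have "set [1..<n + 1] = {1..n}" by auto
  then show ?thesis
    using dfs_reaches.start[of E "[1..<n + 1]"] by (simp add: dfs_state_def unexplored_0)
qed

lemma dfs_state_skip:
  assumes "dfs_state r [] Wh nxt par es" "r \<le> n" "r + 1 \<notin> Wh"
  shows "dfs_state (r + 1) [] Wh nxt par es"
\<comment> \<open>The step from \<open>n\<close> to \<open>n + 1\<close> takes nothing from the root
  order, which is exhausted; it only makes the main loop end.\<close>
proof (cases "r = n")
  case True
  then show ?thesis using assms by (simp add: dfs_state_def)
next
  case False
  then have "[r + 1..<n + 1] = (r + 1) # [r + 1 + 1..<n + 1]"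
    using assms(2) upt_conv_Cons[of "r + 1" "n + 1"] by simp
  then have "dfs_reaches E [1..<n + 1] ((r + 1) # [r + 1 + 1..<n + 1]) [] Wh (unexplored nxt) es"
    using assms(1) unfolding dfs_state_def by metis
  then have "dfs_reaches E [1..<n + 1] [r + 1 + 1..<n + 1] [] Wh (unexplored nxt) es"
    using assms(3) by (rule dfs_reaches.skip_root)
  then show ?thesis
    using assms by (simp add: dfs_state_def)
qed

lemma dfs_state_new_root:
  assumes "dfs_state r [] Wh nxt par es" "r < n" "r + 1 \<in> Wh"
  shows "dfs_state (r + 1) [r + 1] (Wh - {r + 1}) nxt par (es @ [Turns_gray (r + 1)])"
proof -
  have "[r + 1..<n + 1] = (r + 1) # [r + 1 + 1..<n + 1]"
    using assms(2) upt_conv_Cons[of "r + 1" "n + 1"] by simp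
  then have "dfs_reaches E [1..<n + 1] ((r + 1) # [r + 1 + 1..<n + 1]) [] Wh (unexplored nxt) es"
    using assms(1) unfolding dfs_state_def by metis
  then have "dfs_reaches E [1..<n + 1] [r + 1 + 1..<n + 1] [r + 1] (Wh - {r + 1}) (unexplored nxt)
      (es @ [Turns_gray (r + 1)])"
    using assms(3) by (rule dfs_reaches.new_root)
  then show ?thesis
    using assms by (auto simp: dfs_state_def simp del: upt_Suc upt_rec_numeral)
qed

lemma dfs_state_old:
  assumes "dfs_state r (v # S) Wh nxt par es" "nxt v < odeg v" "ohead v (nxt v) \<notin> Wh"
  shows "dfs_state r (v # S) Wh (nxt(v := Suc (nxt v))) par (es @ [Explores_old v (ohead v (nxt v))])"
proof -
  have v: "v \<in> {1..n}" "v \<notin> Wh" "v \<notin> set S"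
    using assms(1) by (auto simp: dfs_state_def)
  have path0: "tree_path nxt par (v # S)"
    using assms(1) by (simp add: dfs_state_def)
  have path: "tree_path (nxt(v := Suc (nxt v))) par (v # S)"
    by (rule tree_path_cong[of nxt par]) (use v path0 in auto)
  have "dfs_reaches E [1..<n + 1] [r + 1..<n + 1] (v # S) Wh (unexplored (nxt(v := Suc (nxt v))))
      (es @ [Explores_old v (ohead v (nxt v))])"
    unfolding unexplored_step[of v nxt, OF v(1) assms(2)]
    using assms unexplored_next[of v nxt] v
    by (intro dfs_reaches.explore_old) (auto simp: dfs_state_def)
  then show ?thesis
    using assms v path unfolding dfs_state_def by (auto simp: Suc_le_eq)
qed

lemma dfs_state_new:
  assumes "dfs_state r (v # S) Wh nxt par es" "nxt v < odeg v" "u = ohead v (nxt v)" "u \<in> Wh"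
  shows "dfs_state r (u # v # S) (Wh - {u}) (nxt(v := Suc (nxt v))) (par(u := omate v (nxt v)))
    (es @ [Explores_new v u, Turns_gray u])"
proof -
  have v: "v \<in> {1..n}" "v \<notin> Wh" "v \<notin> set S" "u \<notin> set (v # S)" "u \<noteq> v"
    using assms(1,4) by (auto simp: dfs_state_def)
  have path0: "tree_path nxt par (v # S)"
    using assms(1) by (simp add: dfs_state_def)
  have "tree_path (nxt(v := Suc (nxt v))) (par(u := omate v (nxt v))) (v # S)"
    by (rule tree_path_cong[of nxt par]) (use v path0 in auto)
  then have path: "tree_path (nxt(v := Suc (nxt v))) (par(u := omate v (nxt v))) (u # v # S)"
    using assms by auto
  have "dfs_reaches E [1..<n + 1] [r + 1..<n + 1] (u # v # S) (Wh - {u})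
      (unexplored (nxt(v := Suc (nxt v)))) (es @ [Explores_new v u, Turns_gray u])"
    unfolding unexplored_step[of v nxt, OF v(1) assms(2)] assms(3)[symmetric]
    using assms unexplored_next[of v nxt] v
    by (intro dfs_reaches.explore_new) (auto simp: dfs_state_def)
  then show ?thesis
    using assms v path unfolding dfs_state_def by (auto simp: Suc_le_eq)
qed

lemma dfs_state_finish_root:
  assumes "dfs_state r [v] Wh nxt par es" "nxt v = odeg v"
  shows "dfs_state r [] Wh nxt par (es @ [Turns_black v])"
proof -
  have "dfs_reaches E [1..<n + 1] [r + 1..<n + 1] [v] Wh (unexplored nxt) es"
    using assms(1) unfolding dfs_state_def by blast
  then have "dfs_reaches E [1..<n + 1] [r + 1..<n + 1] [] Wh (unexplored nxt)
      (es @ [Turns_black v])"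
    using unexplored_done[of v nxt] assms(2) by (intro dfs_reaches.finish_root) simp_all
  then show ?thesis
    using assms(1) by (simp add: dfs_state_def)
qed

lemma dfs_state_finish:
  assumes "dfs_state r (v # u # S) Wh nxt par es" "nxt v = odeg v"
  shows "dfs_state r (u # S) Wh nxt par (es @ [Turns_black v, Withdraws u v])"
proof -
  have "dfs_reaches E [1..<n + 1] [r + 1..<n + 1] (v # u # S) Wh (unexplored nxt) es"
    using assms(1) unfolding dfs_state_def by blast
  then have "dfs_reaches E [1..<n + 1] [r + 1..<n + 1] (u # S) Wh (unexplored nxt)
      (es @ [Turns_black v, Withdraws u v])"
    using unexplored_done[of v nxt] assms(2) by (intro dfs_reaches.finish) simp_all
  then show ?thesis
    using assms(1) by (simp add: dfs_state_def)
qed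

text \<open>\<open>par v\<close> is the \<open>omate\<close> of the tree edge to \<open>v\<close>,
  and \<open>imate\<close> undoes \<open>omate\<close>. Hence \<open>par v\<close> alone yields the
  parent and also the counter of the parent, which is stored nowhere.\<close>

lemma dfs_state_parent:
  assumes "dfs_state r (v # u # S) Wh nxt par es"
  shows "par v < ideg v" "ihead v (par v) = u" "imate v (par v) < odeg u"
    and "nxt u = Suc (imate v (par v))" "v = ohead u (imate v (par v))"
proof -
  from assms obtain q where q: "q < odeg u" "nxt u = Suc q" "v = ohead u q" "par v = omate u q"
    and u: "u \<in> {1..n}"
    by (auto simp: dfs_state_def)
  show "par v < ideg v" "ihead v (par v) = u" "imate v (par v) < odeg u"
    "nxt u = Suc (imate v (par v))" "v = ohead u (imate v (par v))"
    using mate_outs[OF u q(1)] imate_omate[OF u q(1)] q by auto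
qed

lemma card_unexplored_step:
  assumes "u \<in> {1..n}" "nxt u < odeg u"
  shows "Suc (card (unexplored (nxt(u := Suc (nxt u))))) = card (unexplored nxt)"
  unfolding unexplored_step[of u nxt, OF assms]
  by (rule card_Suc_Diff1[OF finite_subset[OF unexplored_subset finite_E] unexplored_next[of u nxt, OF assms]])

end

section \<open>The program\<close>

abbreviation (input) "r_zero \<equiv> 0::nat"
abbreviation (input) "r_last \<equiv> 1::nat"
abbreviation (input) "r_1 \<equiv> 2::nat"
abbreviation (input) "r_5 \<equiv> 3::nat"
abbreviation (input) "r_8 \<equiv> 4::nat"
abbreviation (input) "r_16 \<equiv> 5::nat"
abbreviation (input) "r_32 \<equiv> 6::nat"
abbreviation (input) "r_256 \<equiv> 7::nat"
abbreviation (input) "r_W \<equiv> 8::nat"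
abbreviation (input) "r_root \<equiv> 9::nat"
abbreviation (input) "r_cur \<equiv> 10::nat"
abbreviation (input) "r_par \<equiv> 11::nat"
abbreviation (input) "r_pos \<equiv> 12::nat"
abbreviation (input) "r_top \<equiv> 13::nat"
abbreviation (input) "r_new \<equiv> 14::nat"
abbreviation (input) "r_width \<equiv> 15::nat"
abbreviation (input) "r_range \<equiv> 16::nat"
abbreviation (input) "r_subst \<equiv> 17::nat"
abbreviation (input) "r_val \<equiv> 18::nat"
abbreviation (input) "r_tmp \<equiv> 19::nat"
abbreviation (input) "r_adr \<equiv> 20::nat"
abbreviation (input) "r_buf \<equiv> 21::nat"
abbreviation (input) "r_cnt \<equiv> 22::nat"
abbreviation (input) "r_len \<equiv> 23::nat"
abbreviation (input) "r_deg \<equiv> 24::nat"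

text \<open>\<open>mult\<close> is fixed when the program is built. \<open>r_subst\<close> replaces
  the value \<open>width - 1\<close>; for directed graphs it is the width, which no entry equals, so
  that decoding never sees a replacement.\<close>

definition get_width :: "'a \<Rightarrow> nat \<Rightarrow> 'a com" where
  "get_width ins mult =
     Do (Get_deg ins r_width r_cur) ;;
     Do (Op Add r_width r_width (if mult = 1 then r_zero else r_width)) ;;
     Do (Op Sub r_range r_width r_1) ;;
     Do (Move r_subst (if mult = 1 then r_pos else r_width))"

definition field_length :: "'a com" where
  "field_length =
     Do (Op Add r_len r_width r_width) ;;
     Do (Op Div r_len r_len r_5) ;;
     If_then_else (Less r_len r_W) Skip (Do (Move r_len r_W))"

definition load_buffer :: "'a com" where
  "load_buffer =
     Do (Op Mul r_adr r_width r_32) ;;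
     Do (Load r_buf r_adr r_16) ;;
     Do (Op Add r_tmp r_adr r_16) ;;
     Do (Load r_cnt r_tmp r_16)"

definition push_digit :: "'a com" where
  "push_digit =
     load_buffer ;;
     Do (Op Mul r_buf r_buf r_range) ;;
     Do (Op Add r_buf r_buf r_val) ;;
     Do (Op Add r_cnt r_cnt r_1) ;;
     If_then_else (Less r_cnt r_5) Skip
       (Do (Op Add r_len r_width r_width) ;;
        Do (Store r_top r_len r_buf) ;;
        Do (Op Add r_top r_top r_len) ;;
        Do (Const r_buf 0) ;;
        Do (Const r_cnt 0)) ;;
     Do (Store r_adr r_16 r_buf) ;;
     Do (Store r_tmp r_16 r_cnt)"

text \<open>A count of 0 means that the wanted digit is the fifth of a block. Whatever was pushed
  later has been popped, so this block is the topmost field; it is reloaded as a buffer of five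
  digits.\<close>

definition pop_digit :: "'a com" where
  "pop_digit =
     load_buffer ;;
     If_then_else (Less r_zero r_cnt) Skip
       (Do (Op Add r_len r_width r_width) ;;
        Do (Op Sub r_top r_top r_len) ;;
        Do (Load r_buf r_top r_len) ;;
        Do (Move r_cnt r_5)) ;;
     Do (Op Sub r_cnt r_cnt r_1) ;;
     Do (Op Div r_len r_buf r_range) ;;
     Do (Op Mul r_val r_len r_range) ;;
     Do (Op Sub r_val r_buf r_val) ;;
     Do (Store r_adr r_16 r_len) ;;
     Do (Store r_tmp r_16 r_cnt)"

definition push_field :: "'a com" where
  "push_field =
     field_length ;;
     Do (Store r_top r_len r_val) ;;
     Do (Op Add r_top r_top r_len)"

definition pop_field :: "'a com" where
  "pop_field =
     field_length ;;
     Do (Op Sub r_top r_top r_len) ;;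
     Do (Load r_val r_top r_len)"

definition push :: "'a \<Rightarrow> nat \<Rightarrow> 'a com" where
  "push ins mult =
     get_width ins mult ;;
     If_then_else (Less r_par r_range) (Do (Move r_val r_par)) (Do (Move r_val r_subst)) ;;
     If_then_else (Less r_width r_8) push_digit push_field"

definition pop :: "'a \<Rightarrow> nat \<Rightarrow> 'a com" where
  "pop ins mult =
     get_width ins mult ;;
     If_then_else (Less r_width r_8) pop_digit pop_field ;;
     If_then_else (Equal r_val r_subst) (Do (Move r_par r_range)) (Do (Move r_par r_val))"

definition root_step :: "'a com" where
  "root_step =
     Do (Op Add r_root r_root r_1) ;;
     If_then_else (Less r_root r_last)
       (Do (Op Add r_adr r_root r_256) ;;
        Do (Load r_tmp r_adr r_1) ;;
        If_then_else (Equal r_tmp r_1) Skip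
          (Do (Store r_adr r_1 r_1) ;;
           Do (Move r_cur r_root) ;;
           Do (Call (Turns_gray r_cur)) ;;
           Do (Const r_pos 0)))
       Skip"

text \<open>The push happens while \<open>r_pos\<close> is still the position of the edge to the new
  child; \<open>retreat\<close> pops before it adds 1 to \<open>r_pos\<close>, so both see the same
  \<open>r_subst\<close>. A root has no parent position and is neither pushed nor popped.\<close>

definition explore :: "'a \<Rightarrow> 'a \<Rightarrow> nat \<Rightarrow> 'a com" where
  "explore outs ins mult =
     Do (Get_head outs r_new r_cur r_pos) ;;
     Do (Op Add r_adr r_new r_256) ;;
     Do (Load r_tmp r_adr r_1) ;;
     If_then_else (Equal r_tmp r_1)
       (Do (Call (Explores_old r_cur r_new)) ;;
        Do (Op Add r_pos r_pos r_1))
       (Do (Store r_adr r_1 r_1) ;;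
        Do (Call (Explores_new r_cur r_new)) ;;
        Do (Call (Turns_gray r_new)) ;;
        If_then_else (Equal r_cur r_root) Skip (push ins mult) ;;
        Do (Get_mate outs r_par r_cur r_pos) ;;
        Do (Move r_cur r_new) ;;
        Do (Const r_pos 0))"

text \<open>Vertices are numbered from 1, so 0 in \<open>r_cur\<close> can signal that no vertex is
  gray.\<close>

definition retreat :: "'a \<Rightarrow> nat \<Rightarrow> 'a com" where
  "retreat ins mult =
     Do (Call (Turns_black r_cur)) ;;
     If_then_else (Equal r_cur r_root) (Do (Const r_cur 0))
       (Do (Get_head ins r_new r_cur r_par) ;;
        Do (Get_mate ins r_pos r_cur r_par) ;;
        Do (Call (Withdraws r_new r_cur)) ;;
        Do (Move r_cur r_new) ;;
        If_then_else (Equal r_cur r_root) Skip (pop ins mult) ;;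
        Do (Op Add r_pos r_pos r_1))"

definition dfs_step :: "'a \<Rightarrow> 'a \<Rightarrow> nat \<Rightarrow> 'a com" where
  "dfs_step outs ins mult =
     If_then_else (Equal r_cur r_zero) root_step
       (Do (Get_deg outs r_deg r_cur) ;;
        If_then_else (Equal r_pos r_deg) (retreat ins mult) (explore outs ins mult))"

text \<open>One store of 256 zeros empties all buffers, as \<open>w\<close> is at least 256. With
  \<open>r_W\<close> still 0, the value 1 of \<open>r_tmp\<close> is \<open>2 ^ W\<close>.\<close>

definition constants :: "'a com" where
  "constants =
     Do (Get_n r_last) ;;
     Do (Const r_1 1) ;;
     Do (Const r_5 5) ;;
     Do (Const r_8 8) ;;
     Do (Const r_16 16) ;;
     Do (Const r_32 32) ;;
     Do (Const r_256 256) ;;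
     Do (Store r_zero r_256 r_zero) ;;
     Do (Const r_tmp 1)"

text \<open>The loop that clears the marks also finds the bit length of \<open>n\<close>, by
  doubling \<open>r_tmp\<close> until it exceeds \<open>n\<close>.\<close>

definition clear_step :: "'a com" where
  "clear_step =
     Do (Op Add r_root r_root r_1) ;;
     Do (Op Add r_adr r_root r_256) ;;
     Do (Store r_adr r_1 r_zero) ;;
     If_then_else (Less r_last r_tmp) Skip
       (Do (Op Add r_tmp r_tmp r_tmp) ;;
        Do (Op Add r_W r_W r_1))"

text \<open>With \<open>r_last = n + 1\<close> the main loop goes on below the root \<open>n\<close>
  and ends once the root counter has passed it. The same number, shifted by 256, is the bottom of
  the stack of fields.\<close>

definition reset :: "'a com" where
  "reset =
     Do (Op Add r_last r_last r_1) ;;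
     Do (Op Add r_top r_last r_256) ;;
     Do (Const r_root 0)"

definition dfs_com :: "'a \<Rightarrow> 'a \<Rightarrow> nat \<Rightarrow> 'a com" where
  "dfs_com outs ins mult =
     constants ;;
     While (Less r_root r_last) clear_step ;;
     reset ;;
     While (Less r_root r_last) (dfs_step outs ins mult)"

section \<open>Correctness of the program\<close>

text \<open>The bit of a vertex \<open>v\<close> at the address \<open>256 + v\<close> tells whether \<open>v\<close> is not white. The stack
  of fields starts at the address \<open>n + 257\<close>.\<close>

locale dfs_machine = dfs_graph n I E outs ins mult m + machine w n I B L
  for w n :: nat and I :: "'a access" and E outs ins mult m B L +
  assumes w_ge: "256 \<le> w" "2 * n \<le> 2 ^ w"
    and L: "L = n + 257 + 4 * m div 5"
    and B_ge: "2 ^ 20 + 4 * n + L \<le> B"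
begin

text \<open>The lower bound on \<open>2 ^ R r_W\<close> lets every position in an array fit into
  \<open>W\<close> bits; the upper bound keeps \<open>W\<close> within the word length.\<close>

definition consts_ok :: "(nat \<Rightarrow> nat) \<Rightarrow> bool" where
  "consts_ok R \<longleftrightarrow> R r_zero = 0 \<and> R r_last = n + 1 \<and> R r_1 = 1 \<and> R r_5 = 5 \<and> R r_8 = 8 \<and> R r_16 = 16
     \<and> R r_32 = 32 \<and> R r_256 = 256 \<and> n < 2 ^ R r_W \<and> 2 ^ R r_W \<le> 2 * n"

lemma consts_ok_W_le:
  assumes "consts_ok R"
  shows "R r_W \<le> w"
proof -
  have "2 ^ R r_W \<le> 2 * n"
    using assms by (simp add: consts_ok_def)
  also note w_ge(2)
  finally show ?thesis
    by simp
qed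

lemma L_ge: "n + 257 \<le> L"
  by (simp add: L)

text \<open>Applied with the entry being pushed included in \<open>es\<close>, this bounds the
  memory at its fullest. The rounding in \<open>L\<close> does no harm, since the length of the
  stack is an integer.\<close>

lemma pile_le_L:
  assumes "\<forall>e\<in>set es. valid_entry W e" "sum_list (map fst es) \<le> 2 * m" "pile W es = (x, c, fs)"
  shows "n + 257 + sum_list (map fst fs) \<le> L"
  using pile_size[OF assms(1,3)] assms(2) unfolding L by linarith

text \<open>The registers from \<open>r_width = 15\<close> on hold no value across the steps of the search.\<close>

definition unchanged :: "nat set \<Rightarrow> (nat \<Rightarrow> nat) \<Rightarrow> (nat \<Rightarrow> nat) \<Rightarrow> bool" where
  "unchanged X R R' \<longleftrightarrow> (\<forall>r. r < 15 \<and> r \<notin> X \<longrightarrow> R' r = R r)"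

section \<open>Pushing and popping one entry\<close>

lemma pre_field_length:
  assumes "consts_ok R" "R r_width \<le> 2 * n" "Q (R(r_len := min (2 * R r_width div 5) (R r_W))) M evs"
  shows "pre field_length Q R M evs"
proof (cases "2 * R r_width div 5 < R r_W")
  case True
  then have "min (2 * R r_width div 5) (R r_W) = 2 * R r_width div 5"
    by (rule min_absorb1[OF less_imp_le])
  with True show ?thesis
    using assms B_ge by (simp add: field_length_def consts_ok_def mult_2)
next
  case False
  then have "min (2 * R r_width div 5) (R r_W) = R r_W"
    by simp
  with False show ?thesis
    using assms B_ge by (simp add: field_length_def consts_ok_def mult_2)
qed

lemma pre_load_buffer:
  assumes "consts_ok R" "R r_width = d" "d < 8" "buffers M x c"
    "Q (R(r_adr := d * 32, r_buf := x d, r_tmp := d * 32 + 16, r_cnt := c d)) M evs"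
  shows "pre load_buffer Q R M evs"
proof -
  have "x d < 2 ^ 16" "c d < 2 ^ 16" "load_bits M (d * 32) 16 = x d" "load_bits M (d * 32 + 16) 16 = c d"
    using assms(3,4) load_bits_less[of M _ 16] unfolding buffers_def by (metis assms(3,4))+
  then show ?thesis
    using assms B_ge L_ge w_ge by (simp add: load_buffer_def consts_ok_def)
qed

lemma pre_push_field:
  assumes R: "consts_ok R" "R r_width = d" "R r_val = y" "8 \<le> d" "d \<le> 2 * n"
    and es: "\<forall>e\<in>set ((d, y) # es). valid_entry (R r_W) e" "sum_list (map fst ((d, y) # es)) \<le> 2 * m"
    and M: "stacked (R r_W) (n + 257) M (R r_top) es"
  shows "pre push_field (\<lambda>R' M' evs'. evs' = evs \<and> unchanged {r_top} R R'
    \<and> stacked (R r_W) (n + 257) M' (R' r_top) ((d, y) # es)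
    \<and> (\<forall>a\<in>{256..<n + 257}. M' a = M a)) R M evs"
proof -
  obtain x c fs where p: "pile (R r_W) es = (x, c, fs)" by (metis prod_cases3)
  define l where "l = min (2 * d div 5) (R r_W)"
  have p': "pile (R r_W) ((d, y) # es) = (x, c, (l, y) # fs)"
    using R by (simp add: pile_Cons p l_def)
  have M': "buffers M x c" "fields M (n + 257) (R r_top) fs"
    using M by (auto simp: stacked_def p)
  have le: "R r_top + l \<le> L"
    using pile_le_L[OF es p'] fields_sp[OF M'(2)] by simp
  have y: "y < 2 ^ l"
    using pile_bounds[OF es(1) p'] by auto
  have top: "n + 257 \<le> R r_top"
    using fields_sp[OF M'(2)] by simp
  have lw: "l \<le> w"
    using consts_ok_W_le[OF R(1)] by (simp add: l_def)
  have stacked: "stacked (R r_W) (n + 257) (store_bits M (R r_top) l y) (R r_top + l) ((d, y) # es)"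
    unfolding stacked_def p' using M' top y
    by (auto simp: load_store_same store_bits_outside intro: buffers_cong fields_cong)
  show ?thesis
    unfolding push_field_def pre.simps
    by (rule pre_field_length[OF R(1)])
      (use R(2-) le stacked top lw B_ge in
        \<open>simp_all add: unchanged_def store_bits_outside flip: l_def\<close>)
qed

lemma pre_pop_field:
  assumes R: "consts_ok R" "R r_width = d" "8 \<le> d" "d \<le> 2 * n"
    and es: "\<forall>e\<in>set ((d, y) # es). valid_entry (R r_W) e" "sum_list (map fst ((d, y) # es)) \<le> 2 * m"
    and M: "stacked (R r_W) (n + 257) M (R r_top) ((d, y) # es)"
  shows "pre pop_field (\<lambda>R' M' evs'. evs' = evs \<and> unchanged {r_top} R R' \<and> R' r_val = y
    \<and> R' r_range = R r_range \<and> R' r_subst = R r_subst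
    \<and> stacked (R r_W) (n + 257) M' (R' r_top) es
    \<and> (\<forall>a\<in>{256..<n + 257}. M' a = M a)) R M evs"
proof -
  obtain x c fs where p: "pile (R r_W) es = (x, c, fs)" by (metis prod_cases3)
  define l where "l = min (2 * d div 5) (R r_W)"
  have p': "pile (R r_W) ((d, y) # es) = (x, c, (l, y) # fs)"
    using R by (simp add: pile_Cons p l_def)
  have M': "buffers M x c" "n + 257 + l \<le> R r_top" "load_bits M (R r_top - l) l = y"
    "fields M (n + 257) (R r_top - l) fs"
    using M by (auto simp: stacked_def p')
  have le: "R r_top \<le> L"
    using pile_le_L[OF es p'] fields_sp[OF M'(4)] M'(2) by simp
  have "y < d - 1"
    using es(1) by (simp add: valid_entry_def)
  then have y: "y < B"
    using R(4) B_ge by linarith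
  have lw: "l \<le> w"
    using consts_ok_W_le[OF R(1)] by (simp add: l_def)
  show ?thesis
    unfolding pop_field_def pre.simps
    by (rule pre_field_length[OF R(1)])
      (use R(2-) M' le lw y B_ge in \<open>simp_all add: unchanged_def stacked_def p flip: l_def\<close>)
qed

lemma pre_push_digit:
  assumes R: "consts_ok R" "R r_width = d" "R r_range = d - 1" "R r_val = y" "d < 8"
    and es: "\<forall>e\<in>set ((d, y) # es). valid_entry (R r_W) e" "sum_list (map fst ((d, y) # es)) \<le> 2 * m"
    and M: "stacked (R r_W) (n + 257) M (R r_top) es"
  shows "pre push_digit (\<lambda>R' M' evs'. evs' = evs \<and> unchanged {r_top} R R'
    \<and> stacked (R r_W) (n + 257) M' (R' r_top) ((d, y) # es)
    \<and> (\<forall>a\<in>{256..<n + 257}. M' a = M a)) R M evs"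
proof -
  obtain x c fs where p: "pile (R r_W) es = (x, c, fs)" by (metis prod_cases3)
  have valid: "2 \<le> d" "y < d - 1" "\<forall>e\<in>set es. valid_entry (R r_W) e"
    using es(1) by (auto simp: valid_entry_def)
  have M': "buffers M x c" "fields M (n + 257) (R r_top) fs"
    using M by (auto simp: stacked_def p)
  have top: "n + 257 \<le> R r_top"
    using fields_sp[OF M'(2)] by simp
  have c: "c d < 5" "x d < (d - 1) ^ c d"
    using pile_bounds[OF valid(3) p] by auto
  have "x d < (d - 1) ^ 4"
    using c power_increasing[of "c d" 4 "d - 1"] valid(1) by linarith
  then have x: "x d * (d - 1) + y < 2 ^ (2 * d)"
    using five_digits valid R(5) by blast
  also have "\<dots> \<le> (2::nat) ^ 14"
    using R(5) by (intro power_increasing) auto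
  finally have x': "x d * (d - 1) + y < 2 ^ 14" .
  show ?thesis
  proof (cases "c d = 4")
    case True
    then have p': "pile (R r_W) ((d, y) # es) = (x(d := 0), c(d := 0), (2 * d, x d * (d - 1) + y) # fs)"
      using R by (simp add: pile_Cons p)
    have le: "R r_top + 2 * d \<le> L"
      using pile_le_L[OF es p'] fields_sp[OF M'(2)] by simp
    let ?M = "store_bits M (R r_top) (2 * d) (x d * (d - 1) + y)"
    let ?M' = "store_bits (store_bits ?M (d * 32) 16 0) (d * 32 + 16) 16 0"
    have M'_eq: "?M' a = ?M a" if "256 \<le> a" for a
      using that R(5) by (simp add: store_bits_outside)
    have "buffers ?M x c"
      using M'(1) top by (auto simp: store_bits_outside intro: buffers_cong)
    then have "buffers ?M' (x(d := 0)) (c(d := 0))"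
      using R(5) by (intro buffers_store) auto
    moreover have "fields ?M (n + 257) (R r_top + 2 * d) ((2 * d, x d * (d - 1) + y) # fs)"
      using M'(2) top x by (auto simp: load_store_same store_bits_outside intro: fields_cong)
    then have "fields ?M' (n + 257) (R r_top + 2 * d) ((2 * d, x d * (d - 1) + y) # fs)"
      by (rule fields_cong) (rule M'_eq, simp)
    ultimately have stacked: "stacked (R r_W) (n + 257) ?M' (R r_top + 2 * d) ((d, y) # es)"
      by (simp add: stacked_def p' del: fields.simps)
    have old: "?M' a = M a" if "256 \<le> a" "a < n + 257" for a
      using that M'_eq[of a] top by (simp add: store_bits_outside)
    show ?thesis
      unfolding push_digit_def pre.simps
      by (rule pre_load_buffer[OF R(1,2,5) M'(1)])
        (use R x' le stacked old top True B_ge w_ge L_ge in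
          \<open>simp_all add: unchanged_def consts_ok_def mult_2\<close>)
  next
    case False
    then have p': "pile (R r_W) ((d, y) # es) = (x(d := x d * (d - 1) + y), c(d := Suc (c d)), fs)"
      using R by (simp add: pile_Cons p)
    let ?M = "store_bits (store_bits M (d * 32) 16 (x d * (d - 1) + y)) (d * 32 + 16) 16 (Suc (c d))"
    have M_eq: "?M a = M a" if "256 \<le> a" for a
      using that R(5) by (simp add: store_bits_outside)
    have "buffers ?M (x(d := x d * (d - 1) + y)) (c(d := Suc (c d)))"
      using R(5) M'(1) x' c by (intro buffers_store) auto
    moreover have "fields ?M (n + 257) (R r_top) fs"
      using M'(2) by (rule fields_cong) (rule M_eq, simp)
    ultimately have stacked: "stacked (R r_W) (n + 257) ?M (R r_top) ((d, y) # es)"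
      by (simp add: stacked_def p')
    show ?thesis
      unfolding push_digit_def pre.simps
      by (rule pre_load_buffer[OF R(1,2,5) M'(1)])
        (use R x' stacked M_eq False c B_ge w_ge L_ge in
          \<open>simp_all add: unchanged_def consts_ok_def\<close>)
  qed
qed

lemma pre_pop_digit:
  assumes R: "consts_ok R" "R r_width = d" "R r_range = d - 1" "d < 8"
    and es: "\<forall>e\<in>set ((d, y) # es). valid_entry (R r_W) e" "sum_list (map fst ((d, y) # es)) \<le> 2 * m"
    and M: "stacked (R r_W) (n + 257) M (R r_top) ((d, y) # es)"
  shows "pre pop_digit (\<lambda>R' M' evs'. evs' = evs \<and> unchanged {r_top} R R' \<and> R' r_val = y
    \<and> R' r_range = R r_range \<and> R' r_subst = R r_subst
    \<and> stacked (R r_W) (n + 257) M' (R' r_top) es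
    \<and> (\<forall>a\<in>{256..<n + 257}. M' a = M a)) R M evs"
proof -
  obtain x c fs where p: "pile (R r_W) es = (x, c, fs)" by (metis prod_cases3)
  have valid: "2 \<le> d" "y < d - 1" "\<forall>e\<in>set es. valid_entry (R r_W) e"
    using es(1) by (auto simp: valid_entry_def)
  have c: "c d < 5" "x d < (d - 1) ^ c d"
    using pile_bounds[OF valid(3) p] by auto
  have "x d < (d - 1) ^ 4"
    using c power_increasing[of "c d" 4 "d - 1"] valid(1) by linarith
  then have "x d * (d - 1) + y < 2 ^ (2 * d)"
    using five_digits valid R(4) by blast
  also have "\<dots> \<le> (2::nat) ^ 14"
    using R(4) by (intro power_increasing) auto
  finally have x': "x d * (d - 1) + y < 2 ^ 14" .
  have "x d \<le> x d * (d - 1) + y"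
    using valid(1) by (cases "d - 1") auto
  from le_less_trans[OF this x'] have x16: "x d < 2 ^ 16"
    by simp
  have div: "(x d * (d - 1) + y) div (d - 1) = x d"
    using valid by simp
  define b where "b = d - 1"
  define xd where "xd = x d * b + y"
  note div = div[folded b_def, folded xd_def] and x' = x'[folded b_def, folded xd_def]
  note R' = R(1,2) R(3)[folded b_def] R(4)
  have val: "xd - x d * b = y" "x d * b \<le> xd"
    by (simp_all add: xd_def)
  let ?M = "store_bits (store_bits M (d * 32) 16 (x d)) (d * 32 + 16) 16 (c d)"
  have M_eq: "?M a = M a" if "256 \<le> a" for a
    using that R(4) by (simp add: store_bits_outside)
  show ?thesis
  proof (cases "c d = 4")
    \<comment> \<open>The count 4 is that of \<open>es\<close>, without the entry to be popped: the
      memory shows an empty buffer, and the block of five lies on top.\<close>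
    case True
    then have p': "pile (R r_W) ((d, y) # es) = (x(d := 0), c(d := 0), (2 * d, xd) # fs)"
      using R by (simp add: pile_Cons p xd_def b_def)
    have "n + 257 + 2 * d \<le> R r_top"
      using M by (auto simp: stacked_def p')
    then obtain sp where sp: "R r_top = sp + 2 * d"
      by (metis add.commute le_Suc_ex add.assoc)
    have M': "buffers M (x(d := 0)) (c(d := 0))" "load_bits M sp (2 * d) = xd" "fields M (n + 257) sp fs"
      using M by (auto simp: stacked_def p' sp)
    have le: "sp + 2 * d \<le> L"
      using pile_le_L[OF es p'] fields_sp[OF M'(3)] by simp
    have "buffers ?M x c"
      using buffers_store[OF M'(1) R(4) x16, of "c d"] c(1) by simp
    moreover have "fields ?M (n + 257) sp fs"
      using M'(3) by (rule fields_cong) (rule M_eq, simp)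
    ultimately have stacked: "stacked (R r_W) (n + 257) ?M sp es"
      by (simp add: stacked_def p)
    show ?thesis
      unfolding pop_digit_def pre.simps
      by (rule pre_load_buffer[OF R(1,2,4) M'(1)])
        (use R' sp x' M'(2) le stacked M_eq True B_ge w_ge(1) L_ge div val in
          \<open>simp_all add: unchanged_def consts_ok_def mult_2\<close>)
  next
    case False
    then have p': "pile (R r_W) ((d, y) # es) = (x(d := xd), c(d := Suc (c d)), fs)"
      using R by (simp add: pile_Cons p xd_def b_def)
    have M': "buffers M (x(d := xd)) (c(d := Suc (c d)))" "fields M (n + 257) (R r_top) fs"
      using M by (auto simp: stacked_def p')
    have "buffers ?M x c"
      using buffers_store[OF M'(1) R(4) x16, of "c d"] c(1) by simp
    moreover have "fields ?M (n + 257) (R r_top) fs"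
      using M'(2) by (rule fields_cong) (rule M_eq, simp)
    ultimately have stacked: "stacked (R r_W) (n + 257) ?M (R r_top) es"
      by (simp add: stacked_def p)
    show ?thesis
      unfolding pop_digit_def pre.simps
      by (rule pre_load_buffer[OF R(1,2,4) M'(1)])
        (use R' x' stacked M_eq False c(1) B_ge w_ge(1) L_ge div val in
          \<open>simp_all add: unchanged_def consts_ok_def\<close>)
  qed
qed

lemma consts_ok_upd [simp]: "9 \<le> r \<Longrightarrow> consts_ok (R(r := x)) = consts_ok R"
  by (simp add: consts_ok_def)

lemma unchanged_upd [simp]: "15 \<le> r \<Longrightarrow> unchanged X (R(r := x)) R' = unchanged X R R'"
  by (auto simp: unchanged_def)

lemma unchanged_consts_ok:
  assumes "unchanged X R R'" "X \<inter> {..<9} = {}" "consts_ok R"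
  shows "consts_ok R'"
proof -
  have "R' r = R r" if "r < 9" for r
  proof -
    have "r \<notin> X"
      using assms(2) that by auto
    then show ?thesis
      using assms(1) that by (simp add: unchanged_def)
  qed
  then show ?thesis
    using assms(3) by (simp add: consts_ok_def)
qed

lemma width_le: "u \<in> {1..n} \<Longrightarrow> width u \<le> 2 * n"
  using ideg_le[of u] mult by (auto simp: width_def)

lemma pre_get_width:
  assumes "consts_ok R" "R r_cur \<in> {1..n}" "1 \<le> width (R r_cur)"
    "Q (R(r_width := width (R r_cur), r_range := width (R r_cur) - 1,
          r_subst := if mult = 1 then R r_pos else width (R r_cur))) M evs"
  shows "pre (get_width ins mult) Q R M evs"
  using assms[unfolded width_def] mult ideg_le[of "R r_cur"] B_ge
  by (auto simp: get_width_def consts_ok_def mult_2)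

lemma pre_push:
  assumes R: "consts_ok R" "R r_cur = v" "v \<in> {1..n}"
    and y: "y = (if R r_par < width v - 1 then R r_par else if mult = 1 then R r_pos else width v)"
    and es: "\<forall>e\<in>set ((width v, y) # es). valid_entry (R r_W) e"
      "sum_list (map fst ((width v, y) # es)) \<le> 2 * m"
    and M: "stacked (R r_W) (n + 257) M (R r_top) es"
  shows "pre (push ins mult) (\<lambda>R' M' evs'. evs' = evs \<and> unchanged {r_top} R R'
    \<and> stacked (R r_W) (n + 257) M' (R' r_top) ((width v, y) # es)
    \<and> (\<forall>a\<in>{256..<n + 257}. M' a = M a)) R M evs"
proof -
  let ?Q = "\<lambda>R' M' evs'. evs' = evs \<and> unchanged {r_top} R R'
    \<and> stacked (R r_W) (n + 257) M' (R' r_top) ((width v, y) # es)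
    \<and> (\<forall>a\<in>{256..<n + 257}. M' a = M a)"
  let ?R = "R(r_width := width v, r_range := width v - 1,
    r_subst := if mult = 1 then R r_pos else width v, r_val := y)"
  have w: "1 \<le> width v"
    using es(1) by (simp add: valid_entry_def)
  have "pre (If_then_else (Less r_width r_8) push_digit push_field) ?Q ?R M evs"
  proof (cases "width v < 8")
    case True
    have "pre push_digit ?Q ?R M evs"
      by (rule pre_mono[OF pre_push_digit[of ?R "width v" y]]) (use R es M True in auto)
    with True R(1) show ?thesis by (simp add: consts_ok_def)
  next
    case False
    have "pre push_field ?Q ?R M evs"
      by (rule pre_mono[OF pre_push_field[of ?R "width v" y]]) (use R es M False width_le in auto)
    with False R(1) show ?thesis by (simp add: consts_ok_def)
  qed
  then show ?thesis
    unfolding push_def pre.simps(3)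
    by (intro pre_get_width) (use R w in \<open>auto simp: y\<close>)
qed

lemma pre_pop:
  assumes R: "consts_ok R" "R r_cur = v" "v \<in> {1..n}"
    and p: "p = (if y = (if mult = 1 then R r_pos else width v) then width v - 1 else y)"
    and es: "\<forall>e\<in>set ((width v, y) # es). valid_entry (R r_W) e"
      "sum_list (map fst ((width v, y) # es)) \<le> 2 * m"
    and M: "stacked (R r_W) (n + 257) M (R r_top) ((width v, y) # es)"
  shows "pre (pop ins mult) (\<lambda>R' M' evs'. evs' = evs \<and> unchanged {r_top, r_par} R R' \<and> R' r_par = p
    \<and> stacked (R r_W) (n + 257) M' (R' r_top) es
    \<and> (\<forall>a\<in>{256..<n + 257}. M' a = M a)) R M evs"
proof -
  let ?subst = "if mult = 1 then R r_pos else width v"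
  let ?Q = "\<lambda>R' M' evs'. evs' = evs \<and> unchanged {r_top} R R' \<and> R' r_val = y
    \<and> R' r_range = width v - 1 \<and> R' r_subst = ?subst
    \<and> stacked (R r_W) (n + 257) M' (R' r_top) es
    \<and> (\<forall>a\<in>{256..<n + 257}. M' a = M a)"
  let ?R = "R(r_width := width v, r_range := width v - 1, r_subst := ?subst)"
  have w: "1 \<le> width v"
    using es(1) by (simp add: valid_entry_def)
  have "pre (If_then_else (Less r_width r_8) pop_digit pop_field) ?Q ?R M evs"
  proof (cases "width v < 8")
    case True
    have "pre pop_digit ?Q ?R M evs"
      by (rule pre_mono[OF pre_pop_digit[of ?R "width v" y]]) (use R es M True in auto)
    with True R(1) show ?thesis by (simp add: consts_ok_def)
  next
    case False
    have "pre pop_field ?Q ?R M evs"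
      by (rule pre_mono[OF pre_pop_field[of ?R "width v" y]]) (use R es M False width_le in auto)
    with False R(1) show ?thesis by (simp add: consts_ok_def)
  qed
  then have "pre (If_then_else (Less r_width r_8) pop_digit pop_field)
    (pre (If_then_else (Equal r_val r_subst) (Do (Move r_par r_range)) (Do (Move r_par r_val)))
      (\<lambda>R' M' evs'. evs' = evs \<and> unchanged {r_top, r_par} R R' \<and> R' r_par = p
    \<and> stacked (R r_W) (n + 257) M' (R' r_top) es
    \<and> (\<forall>a\<in>{256..<n + 257}. M' a = M a))) ?R M evs"
    by (rule pre_mono) (auto simp: p unchanged_def)
  then show ?thesis
    unfolding pop_def pre.simps(3)
    by (intro pre_get_width) (use R w in auto)
qed

text \<open>An inner gray vertex \<open>u\<close> of the stack is left over its edge at the position \<open>nxt u - 1\<close>, which in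
  an undirected graph differs from \<open>par u\<close>. This is why \<open>width u - 1\<close> values suffice for \<open>par u\<close>: the
  value \<open>width u - 1\<close> of \<open>par u\<close> is replaced by \<open>nxt u - 1\<close>. In a directed graph,
  \<open>par u < width u - 1\<close> always.\<close>

definition entry :: "(nat \<Rightarrow> nat) \<Rightarrow> (nat \<Rightarrow> nat) \<Rightarrow> nat \<Rightarrow> nat \<times> nat" where
  "entry nxt par u =
     (width u, if par u < width u - 1 then par u else if mult = 1 then nxt u - 1 else width u)"

text \<open>An entry needs both neighbors on the path: the parent position of the first vertex is in
  \<open>r_par\<close>, and the last vertex is a root.\<close>

fun entries :: "(nat \<Rightarrow> nat) \<Rightarrow> (nat \<Rightarrow> nat) \<Rightarrow> nat list \<Rightarrow> (nat \<times> nat) list" where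
  "entries nxt par (x # v # u # S) = entry nxt par v # entries nxt par (v # u # S)"
| "entries nxt par S = []"

lemma entries_cong:
  "(\<And>u. u \<in> set (tl S) \<Longrightarrow> nxt' u = nxt u \<and> par' u = par u) \<Longrightarrow> entries nxt' par' S = entries nxt par S"
  by (induction nxt par S rule: entries.induct) (auto simp: entry_def)

text \<open>With a single array, \<open>par v = width v - 1\<close> forces the child position
  \<open>q\<close> below \<open>width v - 1\<close>, so the replacement is a legal value; it is
  unambiguous because \<open>par v = q\<close> never occurs. With \<open>mult = 2\<close>,
  \<open>par v < ideg v\<close> already gives \<open>par v < width v - 1\<close>.\<close>

lemma entry_decode:
  assumes "tree_path nxt par (x # v # u # S)" "distinct (x # v # u # S)"
    "set (x # v # u # S) \<subseteq> {1..n}" "n < 2 ^ W" "y = snd (entry nxt par v)"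
  shows "valid_entry W (width v, y)"
    and "par v = (if y = (if mult = 1 then nxt v - 1 else width v) then width v - 1 else y)"
proof -
  obtain q where q: "q < odeg v" "nxt v = Suc q" "x = ohead v q"
    using assms(1) by auto
  obtain q' where q': "q' < odeg u" "v = ohead u q'" "par v = omate u q'"
    using assms(1) by auto
  have p: "par v < ideg v" "ihead v (par v) = u"
    using mate_outs[of u q'] q' assms(3) by auto
  have le: "ideg v \<le> n"
    using ideg_le assms(3) by auto
  \<comment> \<open>The child \<open>x\<close> and the parent \<open>u\<close> are different
    vertices of the stack, so they stand at different positions in the array of
    \<open>v\<close>.\<close>
  have neq: "q \<noteq> par v" if "outs = ins"
    using q p assms(2) that by auto
  show "valid_entry W (width v, y)"
    "par v = (if y = (if mult = 1 then nxt v - 1 else width v) then width v - 1 else y)"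
    using mult p(1) le neq q(1,2) assms(4,5)
    by (auto simp: valid_entry_def entry_def width_def)
qed

lemma entries_valid:
  assumes "tree_path nxt par S" "distinct S" "set S \<subseteq> {1..n}" "n < 2 ^ W"
  shows "\<forall>e\<in>set (entries nxt par S). valid_entry W e"
  using assms
proof (induction nxt par S rule: entries.induct)
  case (1 nxt par x v u S)
  then show ?case
    using entry_decode(1)[OF 1(2-5) refl] by (auto simp: entry_def)
qed auto

lemma sum_entries:
  assumes "distinct S" "set S \<subseteq> {1..n}"
  shows "sum_list (map fst (entries nxt par S)) \<le> 2 * m"
proof -
  have "sum_list (map fst (entries nxt par S)) \<le> sum_list (map width (tl S))"
    by (induction nxt par S rule: entries.induct) (auto simp: entry_def)
  also have "\<dots> \<le> 2 * m"
    using assms by (intro sum_width) (cases S; auto)+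
  finally show ?thesis .
qed

text \<open>\<open>nxt\<close> and \<open>par\<close> are ghosts: the machine holds their values
  only for the current vertex, and of the inner vertices of the path only the encoded
  \<open>par\<close>.\<close>

definition matches ::
    "nat list \<Rightarrow> nat set \<Rightarrow> (nat \<Rightarrow> nat) \<Rightarrow> (nat \<Rightarrow> nat) \<Rightarrow> assertion" where
  "matches S Wh nxt par R M evs \<longleftrightarrow>
     consts_ok R \<and> dfs_state (R r_root) S Wh nxt par evs
     \<and> R r_cur = (if S = [] then 0 else hd S) \<and> (S \<noteq> [] \<longrightarrow> R r_pos = nxt (hd S))
     \<and> (tl S \<noteq> [] \<longrightarrow> R r_par = par (hd S)) \<and> (\<forall>v\<in>{1..n}. M (v + 256) \<longleftrightarrow> v \<notin> Wh)
     \<and> stacked (R r_W) (n + 257) M (R r_top) (entries nxt par S)"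

definition at_potential :: "nat \<Rightarrow> assertion" where
  "at_potential k R M evs \<longleftrightarrow>
     (\<exists>S Wh nxt par. matches S Wh nxt par R M evs \<and> k = potential (R r_root) S Wh nxt)"

lemma at_potentialI:
  "matches S Wh nxt par R M evs \<Longrightarrow> potential (R r_root) S Wh nxt < k \<Longrightarrow> \<exists>k'<k. at_potential k' R M evs"
  unfolding at_potential_def by blast

lemma matches_upd [simp]: "14 \<le> r \<Longrightarrow> matches S Wh nxt par (R(r := x)) M evs = matches S Wh nxt par R M evs"
  by (simp add: matches_def)

lemma stacked_mark:
  assumes "stacked W (n + 257) M sp es" "v \<in> {1..n}"
  shows "stacked W (n + 257) (M(v + 256 := x)) sp es"
  using assms(1) by (rule stacked_cong) (use assms(2) in auto)

section \<open>Each step of the search keeps the invariant and lowers the potential\<close>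

lemma pre_root_step:
  assumes "matches [] Wh nxt par R M evs" "R r_root < R r_last"
  shows "pre root_step (\<lambda>R' M' evs'. \<exists>k<potential (R r_root) [] Wh nxt. at_potential k R' M' evs') R M evs"
proof -
  let ?r = "R r_root"
  have R: "consts_ok R" and dfs: "dfs_state ?r [] Wh nxt par evs" and cur: "R r_cur = 0"
    and M: "\<forall>v\<in>{1..n}. M (v + 256) \<longleftrightarrow> v \<notin> Wh"
    and stacked: "stacked (R r_W) (n + 257) M (R r_top) []"
    using assms(1) by (auto simp: matches_def)
  have r: "?r \<le> n"
    using assms(2) R by (simp add: consts_ok_def)
  have Wh: "Wh \<subseteq> {1..n}" and fin: "finite Wh"
    using dfs finite_subset by (auto simp: dfs_state_def)
  show ?thesis
  proof (cases "?r + 1 \<in> Wh")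
    \<comment> \<open>This includes \<open>?r = n\<close>, where no mark is read; hence the two
      alternatives for the registers below.\<close>
    case False
    have pot: "potential (?r + 1) [] Wh nxt < potential ?r [] Wh nxt"
      using r by (simp add: potential_def)
    have "matches [] Wh nxt par (R(r_root := ?r + 1)) M evs"
      using dfs_state_skip[OF dfs r False] R cur M stacked by (simp add: matches_def)
    then have skip: "\<exists>k<potential ?r [] Wh nxt. at_potential k R' M evs"
      if "R' = R(r_root := ?r + 1) \<or> R' = R(r_root := ?r + 1, r_adr := x, r_tmp := y)" for R' x y
      using that pot by (auto intro!: at_potentialI)
    have "?r < n \<longrightarrow> M (?r + 1 + 256)"
      using bspec[OF M, of "?r + 1"] False by simp
    then show ?thesis
      using R r skip B_ge w_ge(1) L_ge
      by (auto simp: root_step_def consts_ok_def load_bits_1)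
  next
    case True
    then have less: "?r < n"
      using Wh by auto
    let ?R = "\<lambda>x y. R(r_root := ?r + 1, r_adr := x, r_tmp := y, r_cur := ?r + 1, r_pos := 0)"
    let ?M = "M(?r + 1 + 256 := True)"
    have nxt: "nxt (?r + 1) = 0"
      using dfs True by (simp add: dfs_state_def)
    have pot: "potential (?r + 1) [?r + 1] (Wh - {?r + 1}) nxt < potential ?r [] Wh nxt"
      using card_Suc_Diff1[OF fin True] r by (simp add: potential_def)
    have "matches [?r + 1] (Wh - {?r + 1}) nxt par (?R x y) ?M (evs @ [Turns_gray (?r + 1)])" for x y
      using dfs_state_new_root[OF dfs less True] R M stacked_mark[OF stacked, of "?r + 1"] less nxt
      by (auto simp: matches_def)
    with pot have new: "\<exists>k<potential ?r [] Wh nxt. at_potential k (?R x y) ?M (evs @ [Turns_gray (?r + 1)])"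
      for x y
      by (intro at_potentialI) auto
    have "\<not> M (?r + 1 + 256)"
      using M True Wh by auto
    then show ?thesis
      using R less new B_ge w_ge(1) L_ge
      by (auto simp: root_step_def consts_ok_def load_bits_1 store_bits_1)
  qed
qed

lemma pre_explore:
  assumes "matches (v # S) Wh nxt par R M evs" "nxt v < odeg v"
  shows "pre (explore outs ins mult)
    (\<lambda>R' M' evs'. \<exists>k<potential (R r_root) (v # S) Wh nxt. at_potential k R' M' evs') R M evs"
proof -
  let ?r = "R r_root"
  define u where "u = ohead v (nxt v)"
  define nxt' where "nxt' = nxt(v := Suc (nxt v))"
  have R: "consts_ok R" and dfs: "dfs_state ?r (v # S) Wh nxt par evs"
    and reg: "R r_cur = v" "R r_pos = nxt v" "S \<noteq> [] \<Longrightarrow> R r_par = par v"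
    and M: "\<forall>v\<in>{1..n}. M (v + 256) \<longleftrightarrow> v \<notin> Wh"
    and stacked: "stacked (R r_W) (n + 257) M (R r_top) (entries nxt par (v # S))"
    using assms(1) by (auto simp: matches_def)
  have v: "v \<in> {1..n}" and fin: "finite Wh" and r: "last (v # S) = ?r" "v \<notin> set S"
    using dfs finite_subset by (auto simp: dfs_state_def)
  have u: "u \<in> {1..n}"
    using ohead_vertex[OF v assms(2)] by (simp add: u_def)
  have card: "Suc (card (unexplored nxt')) = card (unexplored nxt)"
    unfolding nxt'_def using v assms(2) by (rule card_unexplored_step)
  let ?R = "\<lambda>x. R(r_new := u, r_adr := u + 256, r_tmp := x)"
  show ?thesis
  proof (cases "u \<in> Wh")
    case False
    have pot: "potential ?r (v # S) Wh nxt' < potential ?r (v # S) Wh nxt"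
      using card by (simp add: potential_def)
    have "entries nxt' par (v # S) = entries nxt par (v # S)"
      using r by (intro entries_cong) (auto simp: nxt'_def)
    then have "matches (v # S) Wh nxt' par ((?R 1)(r_pos := Suc (nxt v))) M (evs @ [Explores_old v u])"
      using dfs_state_old[of ?r v S, OF dfs assms(2)] False R M reg stacked
      by (simp add: matches_def u_def nxt'_def)
    then have old: "\<exists>k<potential ?r (v # S) Wh nxt.
        at_potential k ((?R 1)(r_pos := Suc (nxt v))) M (evs @ [Explores_old v u])"
      using pot by (intro at_potentialI) auto
    have "M (u + 256)"
      using bspec[OF M u] False by simp
    then show ?thesis
      using R reg v u old B_ge w_ge(1) L_ge assms(2) odeg_le[OF v]
      by (auto simp: explore_def consts_ok_def load_bits_1 simp flip: u_def)
  next
    case True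
    define par' where "par' = par(u := omate v (nxt v))"
    define evs2 where "evs2 = evs @ [Explores_new v u, Turns_gray u]"
    let ?M = "M(u + 256 := True)"
    let ?S = "u # v # S"
    have new: "dfs_state ?r ?S (Wh - {u}) nxt' par' evs2"
      unfolding nxt'_def par'_def evs2_def
      using dfs assms(2) u_def True by (rule dfs_state_new)
    have uS: "u \<noteq> v" "u \<notin> set S" "distinct ?S" "set ?S \<subseteq> {1..n}" "tree_path nxt' par' ?S"
      using new unfolding dfs_state_def by auto
    have nxt_u: "nxt' u = 0" and par_u: "par' u = omate v (nxt v)"
      using dfs True uS(1) by (simp_all add: dfs_state_def nxt'_def par'_def)
    have pot: "potential ?r ?S (Wh - {u}) nxt' < potential ?r (v # S) Wh nxt"
      using card card_Suc_Diff1[OF fin True] by (simp add: potential_def)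
    have stacked': "stacked (R r_W) (n + 257) ?M (R r_top) (entries nxt par (v # S))"
      using stacked u by (rule stacked_mark)
    have valid: "\<forall>e\<in>set (entries nxt' par' ?S). valid_entry (R r_W) e"
      using uS R by (intro entries_valid) (auto simp: consts_ok_def)
    have sum: "sum_list (map fst (entries nxt' par' ?S)) \<le> 2 * m"
      using uS by (intro sum_entries)
    let ?Q = "\<lambda>R' M' evs'. evs' = evs2 \<and> unchanged {r_top} (?R 0) R'
      \<and> stacked (R r_W) (n + 257) M' (R' r_top) (entries nxt' par' ?S)
      \<and> (\<forall>a\<in>{256..<n + 257}. M' a = ?M a)"
    have "pre (If_then_else (Equal r_cur r_root) Skip (push ins mult)) ?Q (?R 0) ?M evs2"
    proof (cases S)
      case Nil
      then show ?thesis
        using stacked' r reg by (simp add: unchanged_def)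
    next
      case (Cons x S')
      then have neq: "v \<noteq> ?r"
        using r by (metis last_ConsR last_in_set list.distinct(1))
      \<comment> \<open>Only the counter of \<open>v\<close> and the parent position of
        \<open>u\<close> have changed, while these entries concern vertices of
        \<open>S\<close>.\<close>
      have "entries nxt par (v # S) = entries nxt' par' (v # S)"
        using r uS by (intro entries_cong) (auto simp: nxt'_def par'_def)
      then have ent: "entries nxt' par' ?S = (width v, snd (entry nxt' par' v)) # entries nxt par (v # S)"
        unfolding Cons by (simp add: entry_def)
      have "pre (push ins mult) ?Q (?R 0) ?M evs2"
        unfolding ent
        by (rule pre_mono[OF pre_push[where v = v and y = "snd (entry nxt' par' v)"
              and es = "entries nxt par (v # S)"]])
          (use R reg v stacked' valid sum ent uS(1) Cons in \<open>auto simp: entry_def nxt'_def par'_def\<close>)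
      with neq reg show ?thesis by simp
    qed
    then have "pre (If_then_else (Equal r_cur r_root) Skip (push ins mult))
      (pre (Do (Get_mate outs r_par r_cur r_pos) ;; Do (Move r_cur r_new) ;; Do (Const r_pos 0))
        (\<lambda>R' M' evs'. \<exists>k<potential ?r (v # S) Wh nxt. at_potential k R' M' evs')) (?R 0) ?M evs2"
    proof (rule pre_mono, elim conjE)
      fix R' M' evs'
      assume Q: "evs' = evs2" "unchanged {r_top} (?R 0) R'"
        "stacked (R r_W) (n + 257) M' (R' r_top) (entries nxt' par' ?S)"
        "\<forall>a\<in>{256..<n + 257}. M' a = ?M a"
      have R': "consts_ok R'"
        using Q(2) by (rule unchanged_consts_ok) (use R in auto)
      have reg': "R' r_cur = v" "R' r_pos = nxt v" "R' r_new = u" "R' r_root = ?r" "R' r_W = R r_W"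
        using Q(2) reg by (auto simp: unchanged_def)
      have M': "\<forall>x\<in>{1..n}. M' (x + 256) \<longleftrightarrow> x \<notin> Wh - {u}"
      proof
        fix x
        assume x: "x \<in> {1..n}"
        then have "M' (x + 256) = ?M (x + 256)"
          using Q(4) by simp
        then show "M' (x + 256) \<longleftrightarrow> x \<notin> Wh - {u}"
          using bspec[OF M x] by simp
      qed
      have "matches ?S (Wh - {u}) nxt' par' (R'(r_par := omate v (nxt v), r_cur := u, r_pos := 0)) M' evs2"
        unfolding matches_def
        using new R' reg' Q(3) M' nxt_u par_u by simp
      then have "\<exists>k<potential ?r (v # S) Wh nxt.
          at_potential k (R'(r_par := omate v (nxt v), r_cur := u, r_pos := 0)) M' evs2"
        using pot reg' by (intro at_potentialI) auto
      moreover have "omate v (nxt v) < B"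
        using mate_outs[OF v assms(2)] ideg_le[OF u] B_ge by (simp add: u_def)
      ultimately show "pre (Do (Get_mate outs r_par r_cur r_pos) ;; Do (Move r_cur r_new) ;; Do (Const r_pos 0))
          (\<lambda>R' M' evs'. \<exists>k<potential ?r (v # S) Wh nxt. at_potential k R' M' evs') R' M' evs'"
        using reg' v assms(2) Q(1) B_ge by simp
    qed
    moreover have "\<not> M (u + 256)"
      using bspec[OF M u] True by simp
    ultimately show ?thesis
      using R reg v u B_ge w_ge(1) L_ge assms(2) odeg_le[OF v]
      by (auto simp: explore_def consts_ok_def load_bits_1 store_bits_1 evs2_def simp flip: u_def)
  qed
qed

lemma pre_retreat:
  assumes "matches (v # S) Wh nxt par R M evs" "nxt v = odeg v"
  shows "pre (retreat ins mult)
    (\<lambda>R' M' evs'. \<exists>k<potential (R r_root) (v # S) Wh nxt. at_potential k R' M' evs') R M evs"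
proof -
  let ?r = "R r_root"
  have R: "consts_ok R" and dfs: "dfs_state ?r (v # S) Wh nxt par evs"
    and reg: "R r_cur = v" "S \<noteq> [] \<Longrightarrow> R r_par = par v"
    and M: "\<forall>v\<in>{1..n}. M (v + 256) \<longleftrightarrow> v \<notin> Wh"
    and stacked: "stacked (R r_W) (n + 257) M (R r_top) (entries nxt par (v # S))"
    using assms(1) by (auto simp: matches_def)
  have v: "v \<in> {1..n}" and r: "last (v # S) = ?r" "v \<notin> set S"
    using dfs by (auto simp: dfs_state_def)
  show ?thesis
  proof (cases S)
    case Nil
    have "matches [] Wh nxt par (R(r_cur := 0)) M (evs @ [Turns_black v])"
      using dfs_state_finish_root[of ?r v] dfs assms(2) R M stacked Nil by (simp add: matches_def)
    then have "\<exists>k<potential ?r (v # S) Wh nxt. at_potential k (R(r_cur := 0)) M (evs @ [Turns_black v])"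
      using Nil by (intro at_potentialI) (auto simp: potential_def)
    then show ?thesis
      using reg r Nil B_ge by (simp add: retreat_def)
  next
    case (Cons u S')
    define evs2 where "evs2 = evs @ [Turns_black v, Withdraws u v]"
    \<comment> \<open>The registers just before the pop: \<open>r_pos\<close> holds the mate, which
      is \<open>nxt u - 1\<close>, as it did at the push.\<close>
    define R0 where "R0 = R(r_new := u, r_pos := nxt u - 1, r_cur := u)"
    note dfs = dfs[unfolded Cons]
    note parent = dfs_state_parent[of ?r v u S', OF dfs]
    have new: "dfs_state ?r (u # S') Wh nxt par evs2"
      unfolding evs2_def using dfs assms(2) by (rule dfs_state_finish)
    have S: "tree_path nxt par (v # u # S')" "distinct (v # u # S')" "set (v # u # S') \<subseteq> {1..n}"
      using dfs by (auto simp: dfs_state_def)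
    have neq: "v \<noteq> ?r"
      using r Cons by (metis last_ConsR last_in_set list.distinct(1))
    let ?Q = "\<lambda>R' M' evs'. evs' = evs2 \<and> unchanged {r_top, r_par} R0 R'
      \<and> (S' \<noteq> [] \<longrightarrow> R' r_par = par u)
      \<and> stacked (R r_W) (n + 257) M' (R' r_top) (entries nxt par (u # S'))
      \<and> (\<forall>a\<in>{256..<n + 257}. M' a = M a)"
    have "pre (If_then_else (Equal r_cur r_root) Skip (pop ins mult)) ?Q R0 M evs2"
    proof (cases S')
      case Nil
      then show ?thesis
        using stacked r reg Cons by (simp add: unchanged_def R0_def)
    next
      case C: (Cons x S'')
      have neq: "u \<noteq> ?r"
        using r S(2) unfolding Cons C by (metis distinct.simps(2) last_ConsR last_in_set list.distinct(1))
      have ent: "entries nxt par (v # S) = (width u, snd (entry nxt par u)) # entries nxt par (u # S')"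
        unfolding Cons C by (simp add: entry_def)
      have valid: "\<forall>e\<in>set (entries nxt par (v # S)). valid_entry (R r_W) e"
        using S R unfolding Cons by (intro entries_valid) (auto simp: consts_ok_def)
      have sum: "sum_list (map fst (entries nxt par (v # S))) \<le> 2 * m"
        using S unfolding Cons by (intro sum_entries)
      have "n < 2 ^ R r_W"
        using R by (simp add: consts_ok_def)
      note decode = entry_decode(2)[OF S[unfolded C] this refl]
      have "pre (pop ins mult) ?Q R0 M evs2"
        by (rule pre_mono[OF pre_pop[where v = u and y = "snd (entry nxt par u)"
              and es = "entries nxt par (u # S')" and p = "par u"]])
          (use R reg S stacked valid sum ent decode in \<open>auto simp: R0_def\<close>)
      with neq show ?thesis by (simp add: R0_def)
    qed
    then have "pre (If_then_else (Equal r_cur r_root) Skip (pop ins mult))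
      (pre (Do (Op Add r_pos r_pos r_1))
        (\<lambda>R' M' evs'. \<exists>k<potential ?r (v # S) Wh nxt. at_potential k R' M' evs')) R0 M evs2"
    proof (rule pre_mono, elim conjE)
      fix R' M' evs'
      assume Q: "evs' = evs2" "unchanged {r_top, r_par} R0 R'" "S' \<noteq> [] \<longrightarrow> R' r_par = par u"
        "stacked (R r_W) (n + 257) M' (R' r_top) (entries nxt par (u # S'))"
        "\<forall>a\<in>{256..<n + 257}. M' a = M a"
      have R': "consts_ok R'"
        using Q(2) by (rule unchanged_consts_ok) (use R in \<open>auto simp: R0_def\<close>)
      have reg': "R' r_cur = u" "R' r_pos = nxt u - 1" "R' r_root = ?r" "R' r_W = R r_W"
        using Q(2) by (auto simp: unchanged_def R0_def)
      have pos: "Suc (nxt u - 1) = nxt u"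
        using parent by simp
      have "matches (u # S') Wh nxt par (R'(r_pos := nxt u)) M' evs2"
        using new R' reg' Q M by (auto simp: matches_def)
      then have "\<exists>k<potential ?r (v # S) Wh nxt. at_potential k (R'(r_pos := nxt u)) M' evs2"
        using reg' Cons by (intro at_potentialI) (auto simp: potential_def)
      moreover have "nxt u < B"
        using parent odeg_le[of u] S(3) B_ge by auto
      ultimately show "pre (Do (Op Add r_pos r_pos r_1))
          (\<lambda>R' M' evs'. \<exists>k<potential ?r (v # S) Wh nxt. at_potential k R' M' evs') R' M' evs'"
        using reg' pos R' Q(1) by (simp add: consts_ok_def)
    qed
    moreover have "u \<in> {1..n}" "nxt u - 1 < B"
      using parent odeg_le[of u] S(3) B_ge by auto
    ultimately show ?thesis
      using reg neq v parent B_ge Cons by (simp add: retreat_def evs2_def R0_def)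
  qed
qed

lemma pre_dfs_step:
  assumes "at_potential k R M evs" "R r_root < R r_last"
  shows "pre (dfs_step outs ins mult) (\<lambda>R' M' evs'. \<exists>k'<k. at_potential k' R' M' evs') R M evs"
proof -
  obtain S Wh nxt par where *: "matches S Wh nxt par R M evs" "k = potential (R r_root) S Wh nxt"
    using assms(1) by (auto simp: at_potential_def)
  have zero: "R r_zero = 0"
    using * by (simp add: matches_def consts_ok_def)
  show ?thesis
  proof (cases S)
    case Nil
    then show ?thesis
      using pre_root_step[of Wh nxt par R] * assms(2) zero by (simp add: dfs_step_def matches_def)
  next
    case (Cons v S')
    then have v: "R r_cur = v" "R r_pos = nxt v" "v \<in> {1..n}" "nxt v \<le> odeg v"
      using *(1) by (auto simp: matches_def dfs_state_def)
    let ?R = "R(r_deg := odeg v)"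
    have m: "matches (v # S') Wh nxt par ?R M evs"
      using *(1) Cons by simp
    have "pre (retreat ins mult) (\<lambda>R' M' evs'. \<exists>k'<k. at_potential k' R' M' evs') ?R M evs"
      if "nxt v = odeg v"
      using pre_retreat[OF m that] *(2) Cons by simp
    moreover have "pre (explore outs ins mult) (\<lambda>R' M' evs'. \<exists>k'<k. at_potential k' R' M' evs') ?R M evs"
      if "nxt v < odeg v"
      using pre_explore[OF m that] *(2) Cons by simp
    ultimately show ?thesis
      using v zero odeg_le[of v] B_ge by (auto simp: dfs_step_def)
  qed
qed

text \<open>The disjunction says that the doubling is over or has happened in every round so far;
  after \<open>n\<close> rounds, \<open>n < 2 ^ n\<close> settles the second case.\<close>

definition clearing :: "nat \<Rightarrow> assertion" where
  "clearing k R M evs \<longleftrightarrow>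
     R r_zero = 0 \<and> R r_last = n \<and> R r_1 = 1 \<and> R r_5 = 5 \<and> R r_8 = 8 \<and> R r_16 = 16 \<and> R r_32 = 32
     \<and> R r_256 = 256 \<and> R r_cur = 0 \<and> R r_root + k = n \<and> evs = []
     \<and> R r_tmp = 2 ^ R r_W \<and> R r_tmp \<le> 2 * n \<and> (n < R r_tmp \<or> R r_W = R r_root)
     \<and> (\<forall>a<256. \<not> M a) \<and> (\<forall>v\<in>{1..R r_root}. \<not> M (v + 256))"

lemma pre_constants: "pre constants (clearing n) (\<lambda>_. 0) M []"
proof -
  have "clearing n (R(r_last := n, r_1 := 1, r_5 := 5, r_8 := 8, r_16 := 16, r_32 := 32, r_256 := 256,
      r_tmp := 1)) (store_bits M 0 256 0) []" if "R = (\<lambda>_. 0)" for R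
    using that n_pos by (auto simp: clearing_def store_bits_def)
  then show ?thesis
    using B_ge w_ge(1) L_ge by (simp add: constants_def)
qed

lemma pre_clear_step:
  assumes "clearing k R M evs" "R r_root < R r_last"
  shows "pre clear_step (\<lambda>R' M' evs'. \<exists>k'<k. clearing k' R' M' evs') R M evs"
proof -
  obtain k' where k: "k = Suc k'"
    using assms by (cases k) (auto simp: clearing_def)
  let ?R = "R(r_root := R r_root + 1, r_adr := R r_root + 1 + 256)"
  let ?M = "M(R r_root + 1 + 256 := False)"
  have M: "(\<forall>a<256. \<not> ?M a) \<and> (\<forall>v\<in>{1..R r_root + 1}. \<not> ?M (v + 256))"
    using assms(1) by (auto simp: clearing_def le_Suc_eq)
  show ?thesis
  proof (cases "n < R r_tmp")
    case True
    then have "clearing k' ?R ?M evs"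
      using assms k M by (simp add: clearing_def)
    then have "\<exists>k'<k. clearing k' ?R ?M evs"
      using k by blast
    then show ?thesis
      using True assms B_ge w_ge(1) L_ge
      by (auto simp: clear_step_def clearing_def store_bits_1)
  next
    case False
    then have "clearing k' (?R(r_tmp := R r_tmp + R r_tmp, r_W := R r_W + 1)) ?M evs"
      using assms k M by (simp add: clearing_def)
    then have "\<exists>k'<k. clearing k' (?R(r_tmp := R r_tmp + R r_tmp, r_W := R r_W + 1)) ?M evs"
      using k by blast
    moreover have "R r_W < n"
      using False assms by (simp add: clearing_def)
    ultimately show ?thesis
      using False assms B_ge w_ge(1) L_ge
      by (auto simp: clear_step_def clearing_def store_bits_1)
  qed
qed

lemma pre_reset:
  assumes "clearing k R M evs" "\<not> R r_root < R r_last"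
  shows "pre reset (at_potential (card E + 3 * n + 1)) R M evs"
proof -
  have R: "R r_root = n" "R r_tmp = 2 ^ R r_W"
    using assms by (auto simp: clearing_def)
  have "n < R r_tmp \<or> R r_W = n"
    using assms(1) R(1) by (auto simp: clearing_def)
  then have W: "n < 2 ^ R r_W"
    using R(2) less_exp[of n] by auto
  let ?R = "R(r_last := n + 1, r_top := n + 257, r_root := 0)"
  have zero: "load_bits M a l = 0" if "a + l \<le> 256" for a l
    using that assms(1) by (simp add: load_bits_def clearing_def)
  have "matches [] {1..n} (\<lambda>_. 0) (\<lambda>_. 0) ?R M evs"
    using assms R W dfs_state_init
    by (auto simp: matches_def clearing_def consts_ok_def stacked_def pile_Nil buffers_def zero)
  then have "at_potential (card E + 3 * n + 1) ?R M evs"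
    unfolding at_potential_def
    by (intro exI conjI) (auto simp: potential_def unexplored_0)
  then show ?thesis
    using assms(1) R B_ge by (simp add: reset_def clearing_def add.commute)
qed

lemma at_potential_final:
  assumes "at_potential k R M evs" "\<not> R r_root < R r_last"
  shows "is_dfs {1..n} E evs"
proof -
  obtain S Wh nxt par where *: "matches S Wh nxt par R M evs"
    using assms(1) by (auto simp: at_potential_def)
  have "S = []" "R r_root = n + 1"
    using * assms(2) by (auto simp: matches_def consts_ok_def dfs_state_def)
  then have "dfs_reaches E [1..<n + 1] [] [] Wh (unexplored nxt) evs"
    using * by (simp add: matches_def dfs_state_def)
  moreover have "set [1..<n + 1] = {1..n}"
    by auto
  ultimately show ?thesis
    unfolding is_dfs_def by (metis distinct_upt)
qed

section \<open>Composition of the program, with its time and space\<close>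

definition time_bound :: nat where
  "time_bound = code_size (constants :: 'a com) + (n * (code_size (clear_step :: 'a com) + 2) + 2
     + (code_size (reset :: 'a com)
       + ((card E + 3 * n + 1) * (code_size (dfs_step outs ins mult) + 2) + 2)))"

lemma run_dfs_com: "run (dfs_com outs ins mult) time_bound (\<lambda>R M evs. is_dfs {1..n} E evs) (\<lambda>_. 0) M []"
proof -
  have main: "run (While (Less r_root r_last) (dfs_step outs ins mult))
      (k * (code_size (dfs_step outs ins mult) + 2) + 2) (\<lambda>R M evs. is_dfs {1..n} E evs) R M evs"
    if "at_potential k R M evs" for k R M evs
  proof -
    have "run (While (Less r_root r_last) (dfs_step outs ins mult))
      (k * (code_size (dfs_step outs ins mult) + 2) + 2)
      (\<lambda>R M evs. \<exists>k. at_potential k R M evs \<and> \<not> holds (Less r_root r_last) R) R M evs"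
      using that by (rule run_While[where J = at_potential]) (simp only: run_pre pre_dfs_step holds.simps)
    then show ?thesis
      by (rule run_mono) (use at_potential_final in \<open>auto simp only: holds.simps\<close>)
  qed
  have reset: "run (reset ;; While (Less r_root r_last) (dfs_step outs ins mult))
      (code_size (reset :: 'a com) + ((card E + 3 * n + 1) * (code_size (dfs_step outs ins mult) + 2) + 2))
      (\<lambda>R M evs. is_dfs {1..n} E evs) R M evs"
    if "clearing k R M evs" "\<not> R r_root < R r_last" for k R M evs
    by (rule run_Seq[OF run_mono[OF run_pre[OF pre_reset[OF that]] order_refl main]])
  have clear: "run (While (Less r_root r_last) clear_step)
      (n * (code_size (clear_step :: 'a com) + 2) + 2)
      (\<lambda>R M evs. \<exists>k. clearing k R M evs \<and> \<not> holds (Less r_root r_last) R) R M evs"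
    if "clearing n R M evs" for R M evs
    using that by (rule run_While[where J = clearing]) (simp only: run_pre pre_clear_step holds.simps)
  have "run constants (code_size (constants :: 'a com)) (clearing n) (\<lambda>_. 0) M []"
    by (rule run_pre[OF pre_constants])
  then have "run constants (code_size (constants :: 'a com))
      (run (While (Less r_root r_last) clear_step ;; reset ;;
          While (Less r_root r_last) (dfs_step outs ins mult))
        (n * (code_size (clear_step :: 'a com) + 2) + 2 + (code_size (reset :: 'a com)
          + ((card E + 3 * n + 1) * (code_size (dfs_step outs ins mult) + 2) + 2)))
        (\<lambda>R M evs. is_dfs {1..n} E evs)) (\<lambda>_. 0) M []"
    by (rule run_mono[OF _ order_refl])
      (rule run_Seq, erule run_mono[OF clear order_refl], use reset in \<open>auto simp only: holds.simps\<close>)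
  then show ?thesis
    unfolding dfs_com_def time_bound_def by (rule run_Seq)
qed

end

definition dfs_program :: "'a \<Rightarrow> 'a \<Rightarrow> nat \<Rightarrow> 'a ram_program" where
  "dfs_program outs ins mult = compile 0 (dfs_com outs ins mult) @ [Halt]"

lemma nat_bitlen_le: "x < 2 ^ b \<Longrightarrow> nat (bitlen (int x)) \<le> b"
  by (simp add: bitlen_def floorlog_leI)

lemma (in dfs_machine) carries_out_dfs_program:
  assumes "B \<le> 2 ^ b"
  shows "\<exists>t s. carries_out_dfs w n I E (dfs_program outs ins mult) M t s \<and> t \<le> time_bound
    \<and> s \<le> L + card (registers (dfs_program outs ins mult)) * b"
proof -
  let ?P = "dfs_program outs ins mult"
  have code: "code_at ?P 0 (compile 0 (dfs_com outs ins mult))"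
    by (auto simp: code_at_def dfs_program_def)
  have fits: "fits (initial M)"
    using B_ge by (simp add: fits_def initial_def)
  have "\<exists>t\<le>time_bound. \<exists>c. reaches ?P t (initial M) c
      \<and> pc c = 0 + code_size (dfs_com outs ins mult) \<and> is_dfs {1..n} E (calls c)"
    using run_dfs_com[of M, unfolded run_def, rule_format, of ?P 0 "initial M"] code fits
    by (simp add: initial_def)
  then obtain t c where t: "t \<le> time_bound" "reaches ?P t (initial M) c"
    "pc c = code_size (dfs_com outs ins mult)" "is_dfs {1..n} E (calls c)"
    by auto
  from reaches_path[OF t(2)] obtain \<gamma> where \<gamma>: "\<gamma> 0 = initial M" "\<gamma> t = c"
    "\<forall>i<t. step w n I ?P (\<gamma> i) = Some (\<gamma> (Suc i))" "\<forall>i\<le>t. fits (\<gamma> i)"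
    by blast
  have "is_run w n I ?P M t \<gamma>"
    using \<gamma> t(3) by (simp add: is_run_def dfs_program_def nth_append)
  then have "carries_out_dfs w n I E ?P M t (space_used ?P t \<gamma>)"
    unfolding carries_out_dfs_def using t(4) \<gamma>(2) by blast
  moreover have "space_used ?P t \<gamma> \<le> L + card (registers ?P) * b"
  proof -
    have "Max ((\<lambda>i. nat (bitlen (int (reg (\<gamma> i) r)))) ` {..t}) \<le> b" for r
    proof -
      have "reg (\<gamma> i) r < 2 ^ b" if "i \<le> t" for i
        using \<gamma>(4) that assms by (auto simp: fits_def intro: less_le_trans)
      then show ?thesis
        by (auto intro: nat_bitlen_le)
    qed
    then have "(\<Sum>r\<in>registers ?P. Max ((\<lambda>i. nat (bitlen (int (reg (\<gamma> i) r)))) ` {..t}))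
        \<le> card (registers ?P) * b"
      using sum_bounded_above[of "registers ?P" _ b] by simp
    moreover have "extent (\<gamma> t) \<le> L"
      using \<gamma>(4) by (simp add: fits_def)
    ultimately show ?thesis
      by (simp add: space_used_def)
  qed
  ultimately show ?thesis
    using t(1) by blast
qed

text \<open>As \<open>m \<le> n * n\<close>, the bound \<open>B\<close> on the registers is at most
  \<open>2 ^ 21 * (n * n)\<close>, so \<open>b = 21 + 2 * k\<close> bits per register suffice. The
  generous factor 300 ensures that \<open>b\<close>, 256 and \<open>k + 1\<close> are at most
  \<open>w\<close>.\<close>

lemma (in dfs_graph) carries_out_dfs_program:
  assumes "300 * (1 + log 2 (real n)) \<le> real w"
  shows "\<exists>t s. carries_out_dfs w n I E (dfs_program outs ins mult) M t s
    \<and> real t \<le> real (code_size (constants :: 'a com) + code_size (clear_step :: 'a com)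
        + code_size (reset :: 'a com) + 4 * code_size (dfs_step outs ins mult) + 14) * (real n + real m)
    \<and> real s \<le> real n + 4 / 5 * real m
        + (257 + real (card (registers (dfs_program outs ins mult))) * (23 + 2 * log 2 (real n)))"
proof -
  define k where "k = nat \<lceil>log 2 (real n)\<rceil>"
  define b where "b = 21 + 2 * k"
  define L where "L = n + 257 + 4 * m div 5"
  define B where "B = 2 ^ 20 + 4 * n + L"
  have log: "0 \<le> log 2 (real n)"
    using n_pos by simp
  have k: "real k \<le> 1 + log 2 (real n)"
    using log by (simp add: k_def) linarith
  have "real n = 2 powr log 2 (real n)"
    using n_pos by simp
  also have "\<dots> \<le> 2 powr real k"
    using log by (intro powr_mono) (auto simp: k_def)
  also have "\<dots> = real (2 ^ k)"
    by (simp add: powr_realpow)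
  finally have nk: "n \<le> 2 ^ k"
    by linarith
  have "card E \<le> card ({1..n} \<times> {1..n})"
    using edges by (intro card_mono) auto
  then have cardE: "card E \<le> n * n" "card E \<le> 2 * m"
    using m mult by (auto simp: card_cartesian_product)
  have "m \<le> n * n"
    using cardE m mult by auto
  moreover have "2 ^ 20 + 4 * n + (n + 257 + 4 * m div 5) \<le> 2 ^ 21 * N"
    if "m \<le> N" "n \<le> N" "1 \<le> N" for N
    using that by simp
  ultimately have "B \<le> 2 ^ 21 * (n * n)"
    unfolding B_def L_def using n_pos by simp
  also have "\<dots> \<le> 2 ^ 21 * (2 ^ k * 2 ^ k)"
    by (rule mult_le_mono2, rule mult_le_mono[OF nk nk])
  also have "\<dots> = 2 ^ b"
    by (simp only: b_def power_add power_even_eq power2_eq_square)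
  finally have Bb: "B \<le> 2 ^ b" .
  have b: "real b \<le> 23 + 2 * log 2 (real n)"
    using k by (simp add: b_def)
  have "real b \<le> real w" "real 256 \<le> real w" "real (k + 1) \<le> real w"
    using b k assms log by simp_all
  then have bw: "b \<le> w" "256 \<le> w" "k + 1 \<le> w"
    by (simp_all only: of_nat_le_iff)
  have Bw: "B \<le> 2 ^ w"
    using Bb power_increasing[OF bw(1), of "2::nat"] by linarith
  have "2 * n \<le> 2 ^ (k + 1)"
    using nk by simp
  also have "\<dots> \<le> (2::nat) ^ w"
    using bw(3) by (intro power_increasing) auto
  finally have nw: "2 * n \<le> 2 ^ w" .
  interpret dfs_machine w n I E outs ins mult m B L
    using Bw bw(2) nw by unfold_locales (simp_all add: L_def B_def)
  obtain t s where ts: "carries_out_dfs w n I E (dfs_program outs ins mult) M t s" "t \<le> time_bound"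
    "s \<le> L + card (registers (dfs_program outs ins mult)) * b"
    using carries_out_dfs_program[OF Bb, of M] by blast
  let ?K = "code_size (constants :: 'a com) + code_size (clear_step :: 'a com)
    + code_size (reset :: 'a com) + 4 * code_size (dfs_step outs ins mult) + 14"
  have "time_bound \<le> ?K * (n + m)"
  proof -
    let ?N = "n + m"
    have one: "1 \<le> ?N"
      using n_pos by simp
    have pot: "card E + 3 * n + 1 \<le> 4 * ?N"
      using n_pos cardE(2) by simp
    have le: "i \<le> i * ?N" for i
      using mult_le_mono2[OF one, of i] by simp
    have "time_bound \<le> code_size (constants :: 'a com) * ?N + (?N * (code_size (clear_step :: 'a com) + 2) + 2 * ?N
        + (code_size (reset :: 'a com) * ?N + ((4 * ?N) * (code_size (dfs_step outs ins mult) + 2) + 2 * ?N)))"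
      unfolding time_bound_def by (intro add_mono mult_le_mono1 le pot) simp
    also have "\<dots> = ?K * ?N"
      by (simp add: algebra_simps)
    finally show ?thesis .
  qed
  with ts(2) have "real t \<le> real (?K * (n + m))"
    by (meson le_trans of_nat_mono)
  then have time: "real t \<le> real ?K * (real n + real m)"
    by (simp only: of_nat_mult of_nat_add)
  have "real s \<le> real L + real (card (registers (dfs_program outs ins mult))) * real b"
    using ts(3) by (metis of_nat_add of_nat_mono of_nat_mult)
  also have "\<dots> \<le> (real n + 257 + 4 / 5 * real m)
      + real (card (registers (dfs_program outs ins mult))) * (23 + 2 * log 2 (real n))"
  proof (intro add_mono mult_left_mono b)
    have "real (4 * m div 5) * 5 \<le> real (4 * m)"
      by (metis div_times_less_eq_dividend of_nat_le_iff of_nat_mult of_nat_numeral)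
    then show "real L \<le> real n + 257 + 4 / 5 * real m"
      by (simp add: L_def)
  qed simp
  finally show ?thesis
    using ts(1) time by (intro exI[of _ t] exI[of _ s]) auto
qed

text \<open>For \<open>n \<ge> 2\<close> the logarithm is at least 1 and absorbs the additive
  constants.\<close>

lemma affine_log_bigo: "(\<lambda>n. a + r * (b + c * log 2 (real n))) \<in> O(\<lambda>n. log 2 (real n))"
proof (rule bigoI[of _ "\<bar>a + r * b\<bar> + \<bar>r * c\<bar>"])
  show "\<forall>\<^sub>F n in sequentially. norm (a + r * (b + c * log 2 (real n)))
      \<le> (\<bar>a + r * b\<bar> + \<bar>r * c\<bar>) * norm (log 2 (real n))"
    using eventually_ge_at_top[of "2::nat"]
  proof eventually_elim
    case (elim n)
    define l where "l = log 2 (real n)"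
    have "log 2 2 \<le> l"
      unfolding l_def using elim by (subst log_le_cancel_iff) auto
    then have l: "1 \<le> l"
      by simp
    have "\<bar>(a + r * b) + (r * c) * l\<bar> \<le> \<bar>a + r * b\<bar> + \<bar>r * c\<bar> * \<bar>l\<bar>"
      by (metis abs_mult abs_triangle_ineq)
    also have "\<dots> \<le> (\<bar>a + r * b\<bar> + \<bar>r * c\<bar>) * \<bar>l\<bar>"
      using l mult_left_mono[of 1 l "\<bar>a + r * b\<bar>"] by (simp add: algebra_simps)
    finally show ?case
      by (simp add: l_def algebra_simps)
  qed
qed

text \<open>An edge has two distinct endpoints and thus gives two pairs, which is the equation
  \<open>mult * card E = 2 * m\<close> of the locale for \<open>mult = 1\<close>.\<close>

lemma dfs_graph_undirected:
  assumes "undirected_graph n E" "represents_undirected n E I"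
  shows "dfs_graph n I {(u, v). {u, v} \<in> E} () () 1 (card E)"
proof -
  have E: "e \<subseteq> {1..n}" "card e = 2" if "e \<in> E" for e
    using assms(1) that by (auto simp: undirected_graph_def)
  have fin: "finite E"
    by (rule finite_subset[of _ "Pow {1..n}"]) (use E in auto)
  have two: "card {(u, v). {u, v} = e} = 2" if "e \<in> E" for e
  proof -
    obtain x y where "e = {x, y}" "x \<noteq> y"
      using E(2)[OF \<open>e \<in> E\<close>] by (auto simp: card_2_iff)
    then have "{(u, v). {u, v} = e} = {(x, y), (y, x)}"
      by (auto simp: doubleton_eq_iff)
    then show ?thesis
      using \<open>x \<noteq> y\<close> by simp
  qed
  have "{(u, v). {u, v} \<in> E} = (\<Union>e\<in>E. {(u, v). {u, v} = e})"
    by auto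
  also have "card \<dots> = (\<Sum>e\<in>E. card {(u, v). {u, v} = e})"
    using fin two by (intro card_UN_disjoint) (auto intro: card_ge_0_finite)
  also have "\<dots> = 2 * card E"
    using two by simp
  finally have card: "card {(u, v). {u, v} \<in> E} = 2 * card E" .
  have adj: "bij_betw (head I () u) {..<deg I () u} {v. {u, v} \<in> E}"
    "\<And>i. i < deg I () u \<Longrightarrow> mate I () u i < deg I () (head I () u i)
      \<and> head I () (head I () u i) (mate I () u i) = u"
    if "u \<in> {1..n}" for u
    using assms(2) that by (auto simp: represents_undirected_def adjacency_arrays_def Let_def)
  have sym: "{v. {v, u} \<in> E} = {v. {u, v} \<in> E}" for u
    by (simp add: insert_commute)
  show ?thesis
  proof
    show "{(u, v). {u, v} \<in> E} \<subseteq> {1..n} \<times> {1..n}"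
      using E(1) by blast
  qed (use assms(1) adj card sym in \<open>auto simp: undirected_graph_def\<close>)
qed

lemma dfs_graph_directed:
  assumes "directed_graph n E" "represents_directed n E I"
  shows "dfs_graph n I E Out In 2 (card E)"
proof -
  have bij: "bij_betw (head I a u) {..<deg I a u}
      (case a of Out \<Rightarrow> {v. (u, v) \<in> E} | In \<Rightarrow> {v. (v, u) \<in> E})" if "u \<in> {1..n}" for a u
    using assms(2) that by (simp add: represents_directed_def adjacency_arrays_def)
  have mate: "mate I a u i < deg I (opposite a) (head I a u i)
      \<and> head I (opposite a) (head I a u i) (mate I a u i) = u"
    if "u \<in> {1..n}" "i < deg I a u" for a u i
    using assms(2) that by (simp add: represents_directed_def adjacency_arrays_def Let_def)
  show ?thesis
    using assms(1) bij[of _ Out] bij[of _ In] mate[of _ _ Out] mate[of _ _ In]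
    by unfold_locales (simp_all add: directed_graph_def)
qed

text \<open>Kept abstract in the kind of graph, so that both halves of the theorem are
  instances.\<close>

lemma dfs_program_bounds:
  fixes outs ins :: 'a and edges_of :: "'e set \<Rightarrow> (nat \<times> nat) set"
  assumes "\<And>n E I. graph n E \<Longrightarrow> represents n E I \<Longrightarrow>
    dfs_graph n I (edges_of E) outs ins mult (card E)"
  shows "\<exists>(P :: 'a ram_program) (c :: real) (C :: real) (f :: nat \<Rightarrow> real).
        f \<in> O(\<lambda>n. log 2 (real n)) \<and>
        (\<forall>n E I w M.
           graph n E \<and> represents n E I \<and>
           c * (1 + log 2 (real n)) \<le> real w \<longrightarrow>
           (\<exists>t s. carries_out_dfs w n I (edges_of E) P M t s \<and>
              real t \<le> C * (real n + real (card E)) \<and>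
              real s \<le> real n + 4 / 5 * real (card E) + f n))"
proof -
  let ?C = "real (code_size (constants :: 'a com) + code_size (clear_step :: 'a com)
    + code_size (reset :: 'a com) + 4 * code_size (dfs_step outs ins mult) + 14)"
  let ?f = "\<lambda>n. 257 + real (card (registers (dfs_program outs ins mult))) * (23 + 2 * log 2 (real n))"
  have "\<forall>n E I w M. graph n E \<and> represents n E I \<and> 300 * (1 + log 2 (real n)) \<le> real w \<longrightarrow>
      (\<exists>t s. carries_out_dfs w n I (edges_of E) (dfs_program outs ins mult) M t s \<and>
         real t \<le> ?C * (real n + real (card E)) \<and>
         real s \<le> real n + 4 / 5 * real (card E) + ?f n)"
    using dfs_graph.carries_out_dfs_program[OF assms] by blast
  then show ?thesis
    using affine_log_bigo by blast
qed

theorem theorem4p2: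
  shows
    "(\<exists>(P :: unit ram_program) (c :: real) (C :: real) (f :: nat \<Rightarrow> real).
        f \<in> O(\<lambda>n. log 2 (real n)) \<and>
        (\<forall>n E I w M.
           undirected_graph n E \<and> represents_undirected n E I \<and>
           c * (1 + log 2 (real n)) \<le> real w \<longrightarrow>
           (\<exists>t s. carries_out_dfs w n I {(u, v). {u, v} \<in> E} P M t s \<and>
              real t \<le> C * (real n + real (card E)) \<and>
              real s \<le> real n + 4 / 5 * real (card E) + f n)))
     \<and>
     (\<exists>(P :: side ram_program) (c :: real) (C :: real) (f :: nat \<Rightarrow> real).
        f \<in> O(\<lambda>n. log 2 (real n)) \<and>
        (\<forall>n E I w M.
           directed_graph n E \<and> represents_directed n E I \<and>
           c * (1 + log 2 (real n)) \<le> real w \<longrightarrow>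
           (\<exists>t s. carries_out_dfs w n I E P M t s \<and>
              real t \<le> C * (real n + real (card E)) \<and>
              real s \<le> real n + 4 / 5 * real (card E) + f n)))"
  using dfs_program_bounds[of undirected_graph represents_undirected "\<lambda>E. {(u, v). {u, v} \<in> E}",
      OF dfs_graph_undirected]
    dfs_program_bounds[of directed_graph represents_directed "\<lambda>E. E", OF dfs_graph_directed]
  by (rule conjI)

end
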